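(* Let $n$ and $l$ be positive integers. The essential height of an $l$-generated associative $\mathrm{PI}$-algebra over a field satisfying an admissible polynomial identity of degree $n$, over the set of words (in the generators) of length less than $n$, is less than $$\Upsilon(n,l) = 2n^{3\lceil\log_3 n\rceil + 4}\, l.$$
   Context: An admissible polynomial identity is a polynomial identity (in noncommuting variables) having coefficient $1$ at some term of the highest degree. $\lceil x\rceil=-[-x]$ denotes the least integer not less than $x$. An algebra $A$ has essential height $h$ over a finite set $Y\subset A$ if $h$ is the minimal integer for which there exists a finite set $D\subset A$ such that $A$ is linearly spanned by elements of the form $t_1\cdot t_2\cdots t_r$, where $r\leqslant 2h+1$, for every $i$ either $t_i\in D$ or $t_i=y_i^{k_i}$ with $y_i\in Y$, and the set of indices $i$ such that $t_i\notin D$ contains not more than $h$ elements. *)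

theory Defs
  imports Complex_Main "HOL-Library.Poly_Mapping"
begin

(* The class ring has no unit, so products and powers are formed over nonempty lists only;
   the value at the empty list is a dummy and is never used below. *)
fun list_prod :: "'a::ring list \<Rightarrow> 'a" where
  "list_prod [] = 0"
| "list_prod [x] = x"
| "list_prod (x # y # ys) = x * list_prod (y # ys)"

definition words_below :: "'a::ring set \<Rightarrow> nat \<Rightarrow> 'a set" where
  "words_below X n = {list_prod w | w. w \<noteq> [] \<and> set w \<subseteq> X \<and> length w < n}"

(* Noncommutative polynomials: finitely supported maps from words in the variables
   x_0, x_1, ... to the coefficient field. *)
type_synonym 'k ncpoly = "nat list \<Rightarrow>\<^sub>0 'k"

definition nc_degree :: "'k::zero ncpoly \<Rightarrow> nat" where
  "nc_degree f = Max (length ` Poly_Mapping.keys f)"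

(* The constant term must vanish: it cannot be evaluated in an algebra without unit, and in a
   nonzero unital algebra an identity has constant term 0 (substitute 0 for all variables). *)
definition admissible :: "'k::field ncpoly \<Rightarrow> bool" where
  "admissible f \<longleftrightarrow> Poly_Mapping.lookup f [] = 0 \<and>
     (\<exists>w. length w = nc_degree f \<and> Poly_Mapping.lookup f w = 1)"

locale assoc_algebra = vector_space scale
  for scale :: "'k::field \<Rightarrow> 'a::ring \<Rightarrow> 'a" +
  assumes scale_mult_left: "scale c x * y = scale c (x * y)"
    and scale_mult_right: "x * scale c y = scale c (x * y)"
begin

definition subalgebra :: "'a set \<Rightarrow> bool" where
  "subalgebra S \<longleftrightarrow> subspace S \<and> (\<forall>x\<in>S. \<forall>y\<in>S. x * y \<in> S)"

(* If the algebra has an identity element, it may be used in addition to X. Thus unital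
   algebras generated by X as unital algebras are covered, as are algebras without unit. *)
definition generates :: "'a set \<Rightarrow> bool" where
  "generates X \<longleftrightarrow> subalgebra hull (X \<union> {e. \<forall>x. e * x = x \<and> x * e = x}) = UNIV"

definition nc_eval :: "'k ncpoly \<Rightarrow> (nat \<Rightarrow> 'a) \<Rightarrow> 'a" where
  "nc_eval f a = (\<Sum>w\<in>Poly_Mapping.keys f. scale (Poly_Mapping.lookup f w) (list_prod (map a w)))"

definition satisfies_identity :: "'k ncpoly \<Rightarrow> bool" where
  "satisfies_identity f \<longleftrightarrow> (\<forall>a. nc_eval f a = 0)"

definition essential_products :: "'a set \<Rightarrow> 'a set \<Rightarrow> nat \<Rightarrow> 'a set" where
  "essential_products Y D h =
     {list_prod ts | ts. ts \<noteq> [] \<and> length ts \<le> 2 * h + 1 \<and>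
        (\<forall>i<length ts. ts ! i \<in> D \<or> (\<exists>y\<in>Y. \<exists>k>0. ts ! i = list_prod (replicate k y))) \<and>
        card {i. i < length ts \<and> ts ! i \<notin> D} \<le> h}"

definition essentially_spanned :: "'a set \<Rightarrow> nat \<Rightarrow> bool" where
  "essentially_spanned Y h \<longleftrightarrow> (\<exists>D. finite D \<and> span (essential_products Y D h) = UNIV)"

definition has_essential_height :: "'a set \<Rightarrow> nat \<Rightarrow> bool" where
  "has_essential_height Y h \<longleftrightarrow>
     finite Y \<and> essentially_spanned Y h \<and> (\<forall>h'<h. \<not> essentially_spanned Y h')"

end

definition Upsilon :: "nat \<Rightarrow> nat \<Rightarrow> nat" where
  "Upsilon n l = 2 * n ^ (3 * nat \<lceil>log 3 (real n)\<rceil> + 4) * l"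

end

theory Submission
  imports Defs "HOL-Library.List_Lexorder" "HOL-Library.Multiset"
begin

text \<open>
  Call a word \<open>n\<close>-divisible if it has the form \<open>w0 w1 ... wn\<close> where every block \<open>wi\<close> with
  \<open>i \<ge> 1\<close> beats each later block at the first letter in which the two differ. Permuting
  \<open>w1, ..., wn\<close> nontrivially makes such a word lexicographically smaller. An admissible identity
  of degree \<open>n\<close> has a multilinear consequence that expresses \<open>y1 ... yn\<close> by the products
  of \<open>y1, ..., yn\<close> in other orders (\<open>multilinear_identity\<close>), so \<open>n\<close>-divisible words are linear combinations of smaller words, and
  the algebra is spanned by the words that are not \<open>n\<close>-divisible
  (\<open>word_in_span_of_indivisible\<close>). What remains is combinatorics of such words \<open>w\<close>.

  A long factor of \<open>w\<close> must contain a high power of a word \<open>u\<close> with fewer than \<open>n\<close> letters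
  (\<open>high_power_factor\<close>). Cutting out such powers greedily, \<open>w\<close> becomes an alternating product of
  high powers \<open>u i ^ k i\<close>, the fragments, and of words of bounded length, which go into the
  finite set \<open>D\<close>. The essential height is at most the number of fragments, so this number has to
  be bounded independently of \<open>w\<close>.

  A fragment contains all rotations of the periodic word \<open>u i u i u i ...\<close>, in any desired order.
  Hence there is no sequence of \<open>n\<close> rotations, taken from fragments in their order along \<open>w\<close>,
  that strictly decreases (\<open>chain_ends_empty\<close>). Record for each \<open>c < n - 1\<close> the greatest word
  that ends a decreasing sequence of \<open>c + 1\<close> rotations taken from the fragments up to \<open>i\<close>. These
  \<open>n - 1\<close> records never decrease with \<open>i\<close>, and every rotation from fragment \<open>i\<close> is one of the
  records at \<open>i\<close> (\<open>member_is_max_chain_end\<close>). It follows that the tuple of the first letters of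
  the records takes at most \<open>n l\<close> values. While the tuple of prefixes of length \<open>k\<close> is constant,
  the tuple of prefixes of length \<open>3 k\<close> takes at most \<open>n ^ 3\<close> values, because the second and the
  third part of a prefix are prefixes of other rotations, and so occur in the constant tuple. With
  \<open>t\<close> steps \<open>k \<mapsto> 3 k\<close>, where \<open>3 ^ t \<ge> n\<close>, the tuple of prefixes of length \<open>3 ^ t\<close> takes at most
  \<open>n l (n ^ 3) ^ t\<close> values (\<open>card_prefix_tuples\<close>).

  A value of this tuple leaves at most \<open>(n - 1)\<^sup>2\<close> possibilities for \<open>u i\<close>, since \<open>u i\<close> is a prefix
  of a record and has fewer than \<open>n\<close> letters. Finally, one word \<open>v\<close> can be \<open>u i\<close> for at most
  \<open>2 (n - 1)\<close> fragments before the last one: the letters after the fragment deviate from the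
  period to a smaller or to a greater word, and \<open>n\<close> deviations to the same side would make \<open>w\<close>
  divisible (\<open>repetitions_bound\<close>). Altogether there are fewer than
  \<open>2 n ^ (3 t + 4) l\<close> fragments, and \<open>t = \<lceil>log 3 n\<rceil>\<close> gives the claim.
\<close>

section \<open>Counting values of monotone tuples\<close>

lemma card_image_le_if_determined:
  assumes "finite J" "\<And>i i'. i \<in> J \<Longrightarrow> i' \<in> J \<Longrightarrow> g i = g i' \<Longrightarrow> f i = f i'"
  shows "card (f ` J) \<le> card (g ` J)"
proof -
  have "f ` J = (\<lambda>y. f (inv_into J g y)) ` (g ` J)"
  proof -
    have "f i = f (inv_into J g (g i))" if "i \<in> J" for i
      using assms(2)[OF that, of "inv_into J g (g i)"] that
      by (simp add: inv_into_into f_inv_into_f)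
    then show ?thesis by (simp add: image_image)
  qed
  then show ?thesis using assms(1) by (metis card_image_le finite_imageI)
qed

text \<open>
  The sum of the ranks of the coordinates cannot decrease along \<open>J\<close>, and it is constant only where
  every coordinate is constant. So it distinguishes the tuples, and it lies between \<open>0\<close>
  and \<open>R * r\<close>.
\<close>
lemma card_monotone_tuples:
  fixes g :: "nat \<Rightarrow> nat \<Rightarrow> 'b::linorder"
  assumes fin: "finite J"
    and mono: "\<And>c i i'. c < R \<Longrightarrow> i \<in> J \<Longrightarrow> i' \<in> J \<Longrightarrow> i \<le> i' \<Longrightarrow> g c i \<le> g c i'"
    and few: "\<And>c. c < R \<Longrightarrow> card (g c ` J) \<le> Suc r"
  shows "card ((\<lambda>i. map (\<lambda>c. g c i) [0..<R]) ` J) \<le> Suc (R * r)"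
proof -
  define rank where "rank c i = card {y \<in> g c ` J. y < g c i}" for c i
  have rank_le: "rank c i \<le> r" if "c < R" "i \<in> J" for c i
  proof -
    have "{y \<in> g c ` J. y < g c i} \<subset> g c ` J" using that by blast
    then have "rank c i < card (g c ` J)" unfolding rank_def using fin by (intro psubset_card_mono) auto
    then show ?thesis using few[OF that(1)] by simp
  qed
  have rank_mono: "rank c i \<le> rank c i'" if "c < R" "i \<in> J" "i' \<in> J" "i \<le> i'" for c i i'
    unfolding rank_def using fin mono[OF that] by (intro card_mono) auto
  have rank_strict: "g c i = g c i'" if "c < R" "i \<in> J" "i' \<in> J" "i \<le> i'" "rank c i = rank c i'" for c i i'
  proof (rule ccontr)
    assume "g c i \<noteq> g c i'"
    then have "g c i < g c i'" using mono[OF that(1-4)] by simp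
    then have "{y \<in> g c ` J. y < g c i} \<subset> {y \<in> g c ` J. y < g c i'}" using that(2) by force
    then have "rank c i < rank c i'" unfolding rank_def using fin by (intro psubset_card_mono) auto
    then show False using that(5) by simp
  qed
  define total where "total i = (\<Sum>c<R. rank c i)" for i
  have eq: "map (\<lambda>c. g c i) [0..<R] = map (\<lambda>c. g c i') [0..<R]"
    if "i \<in> J" "i' \<in> J" "i \<le> i'" "total i = total i'" for i i'
  proof -
    have "rank c i = rank c i'" if "c < R" for c
    proof (rule ccontr)
      assume "rank c i \<noteq> rank c i'"
      then have "rank c i < rank c i'" using rank_mono that \<open>i \<in> J\<close> \<open>i' \<in> J\<close> \<open>i \<le> i'\<close> by (metis order_le_less)
      then have "total i < total i'" unfolding total_def
        using rank_mono that \<open>i \<in> J\<close> \<open>i' \<in> J\<close> \<open>i \<le> i'\<close> by (intro sum_strict_mono_ex1) auto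
      then show False using \<open>total i = total i'\<close> by simp
    qed
    then have "g c i = g c i'" if "c < R" for c
      using rank_strict[OF that \<open>i \<in> J\<close> \<open>i' \<in> J\<close> \<open>i \<le> i'\<close>] that by blast
    then show ?thesis by simp
  qed
  have "card ((\<lambda>i. map (\<lambda>c. g c i) [0..<R]) ` J) \<le> card (total ` J)"
  proof (rule card_image_le_if_determined[OF fin])
    fix i i' assume *: "i \<in> J" "i' \<in> J" "total i = total i'"
    show "map (\<lambda>c. g c i) [0..<R] = map (\<lambda>c. g c i') [0..<R]"
      using nat_le_linear[of i i']
    proof
      assume "i \<le> i'"
      then show ?thesis by (rule eq[OF *(1,2) _ *(3)])
    next
      assume "i' \<le> i"
      then show ?thesis by (rule eq[OF *(2,1) _ *(3)[symmetric], symmetric])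
    qed
  qed
  also have "\<dots> \<le> card {..R * r}"
  proof (intro card_mono)
    have "total i \<le> R * r" if "i \<in> J" for i
      unfolding total_def using sum_bounded_above[of "{..<R}" "\<lambda>c. rank c i" r] rank_le that by simp
    then show "total ` J \<subseteq> {..R * r}" by auto
  qed simp
  finally show ?thesis by simp
qed

lemma card_image_fibers:
  assumes "finite J" "card (f ` J) \<le> A"
    and "\<And>s. s \<in> f ` J \<Longrightarrow> card (g ` {i \<in> J. f i = s}) \<le> B"
  shows "card (g ` J) \<le> A * B"
proof -
  have "g ` J = (\<Union>s\<in>f ` J. g ` {i \<in> J. f i = s})" by blast
  then have "card (g ` J) \<le> (\<Sum>s\<in>f ` J. card (g ` {i \<in> J. f i = s}))"
    using assms(1) by (metis card_UN_le finite_imageI)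
  also have "\<dots> \<le> card (f ` J) * B" using sum_bounded_above[of "f ` J" "\<lambda>s. card (g ` {i \<in> J. f i = s})" B] assms(3) by auto
  also have "\<dots> \<le> A * B" using assms(2) by simp
  finally show ?thesis .
qed

section \<open>Greatest ends of decreasing chains\<close>

text \<open>
  The ends \<open>x c\<close> of chains \<open>x 0 > x 1 > ... > x c\<close> with \<open>x m \<in> V (i m)\<close> and
  \<open>i 0 \<le> i 1 \<le> ... \<le> i c \<le> i\<close>. The indices need not increase strictly, so a set \<open>V i\<close> may
  contribute several members to a chain.
\<close>
fun chain_ends :: "(nat \<Rightarrow> 'a::linorder set) \<Rightarrow> nat \<Rightarrow> nat \<Rightarrow> 'a set" where
  "chain_ends V 0 i = (\<Union>i'\<le>i. V i')"
| "chain_ends V (Suc c) i = {x. \<exists>i'\<le>i. x \<in> V i' \<and> (\<exists>y\<in>chain_ends V c i'. x < y)}"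

text \<open>The value is \<open>bot\<close> as long as there is no chain with \<open>c + 1\<close> members.\<close>
definition max_chain_end :: "(nat \<Rightarrow> 'a::{linorder,order_bot} set) \<Rightarrow> nat \<Rightarrow> nat \<Rightarrow> 'a" where
  "max_chain_end V c i = Max (insert bot (chain_ends V c i))"

lemma chain_ends_mono: "i \<le> i' \<Longrightarrow> chain_ends V c i \<subseteq> chain_ends V c i'"
  by (cases c) (auto intro: order_trans)

lemma chain_ends_subset: "chain_ends V c i \<subseteq> (\<Union>i'\<le>i. V i')"
  by (cases c) auto

lemma finite_chain_ends: "(\<And>i. finite (V i)) \<Longrightarrow> finite (chain_ends V c i)"
  by (rule finite_subset[OF chain_ends_subset]) auto

lemma chain_ends_at: "x \<in> chain_ends V c i \<Longrightarrow> \<exists>i'\<le>i. x \<in> V i' \<and> x \<in> chain_ends V c i'"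
  by (cases c) auto

lemma max_chain_end_mono:
  assumes "\<And>i. finite (V i)" "i \<le> i'" shows "max_chain_end V c i \<le> max_chain_end V c i'"
  unfolding max_chain_end_def using chain_ends_mono[OF assms(2), of V c] finite_chain_ends[of V c, OF assms(1)]
  by (intro Max_mono) auto

lemma chain_ends_le_max:
  assumes "\<And>i. finite (V i)" "x \<in> chain_ends V c i" shows "x \<le> max_chain_end V c i"
  unfolding max_chain_end_def using finite_chain_ends[of V c i, OF assms(1)] assms(2) by simp

text \<open>
  A maximum is an element of some \<open>V i'\<close>, and from that index on it is already the maximum. This
  dates every value of the record to a set that contains it.
\<close>
lemma max_chain_end_cases:
  assumes "\<And>i. finite (V i)"
  shows "max_chain_end V c i = bot \<or> (\<exists>i'\<le>i. max_chain_end V c i \<in> V i' \<and> max_chain_end V c i' = max_chain_end V c i)"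
proof -
  have "max_chain_end V c i \<in> insert bot (chain_ends V c i)"
    unfolding max_chain_end_def using finite_chain_ends[of V c i, OF assms] by (intro Max_in) auto
  then consider "max_chain_end V c i = bot" | "max_chain_end V c i \<in> chain_ends V c i" by blast
  then show ?thesis
  proof cases
    case 2
    then obtain i' where i': "i' \<le> i" "max_chain_end V c i \<in> V i'" "max_chain_end V c i \<in> chain_ends V c i'"
      using chain_ends_at by blast
    then have "max_chain_end V c i' = max_chain_end V c i"
      using chain_ends_le_max[of V, OF assms] max_chain_end_mono[of V, OF assms] by (meson order_antisym)
    then show ?thesis using i' by blast
  qed simp
qed

text \<open>
  Let \<open>c + 1\<close> be the length of the longest chain that ends in \<open>v\<close>. If the maximum for \<open>c\<close> were
  greater than \<open>v\<close>, then \<open>v\<close> would prolong the chain of that maximum. In this way \<open>R\<close> monotone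
  functions cover all \<open>V i\<close>, which Dilworth's theorem would give as a cover by \<open>R\<close> chains.
\<close>
lemma member_is_max_chain_end:
  assumes fin: "\<And>i. finite (V i)" and empty: "chain_ends V R i = {}" and v: "v \<in> V i"
  shows "\<exists>c<R. max_chain_end V c i = v"
proof -
  have 0: "v \<in> chain_ends V 0 i" using v by auto
  define c where "c = (GREATEST c. c \<le> R \<and> v \<in> chain_ends V c i)"
  have c: "c \<le> R \<and> v \<in> chain_ends V c i" unfolding c_def
    by (rule GreatestI_nat[where b = R and k = 0]) (use 0 in auto)
  have max: "c' \<le> c" if "c' \<le> R" "v \<in> chain_ends V c' i" for c' unfolding c_def
    by (rule Greatest_le_nat[where b = R]) (use that in auto)
  have "c < R" using c empty by (metis empty_iff order_le_less)
  have "\<not> v < max_chain_end V c i"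
  proof
    assume less: "v < max_chain_end V c i"
    have "max_chain_end V c i \<in> insert bot (chain_ends V c i)"
      unfolding max_chain_end_def using finite_chain_ends[of V c i, OF fin] by (intro Max_in) auto
    then have "max_chain_end V c i \<in> chain_ends V c i" using less by auto
    then have "v \<in> chain_ends V (Suc c) i" using v less by auto
    then show False using max[of "Suc c"] \<open>c < R\<close> by simp
  qed
  then have "max_chain_end V c i = v" using chain_ends_le_max[of V, OF fin] c by force
  then show ?thesis using \<open>c < R\<close> by blast
qed

section \<open>Rotations of periodic words\<close>

lemma take_mono_lex: "xs \<le> ys \<Longrightarrow> take k xs \<le> take k (ys :: 'a::linorder list)"
proof (induction k arbitrary: xs ys)
  case (Suc k)
  then show ?case by (cases xs; cases ys) auto
qed simp

text \<open>The \<open>k\<close> letters from position \<open>j\<close> of the infinite word \<open>u u u ...\<close>.\<close>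
definition periodic :: "nat \<Rightarrow> 'a list \<Rightarrow> nat \<Rightarrow> 'a list" where
  "periodic k u j = map (\<lambda>m. u ! ((j + m) mod length u)) [0..<k]"

lemma length_periodic [simp]: "length (periodic k u j) = k"
  by (simp add: periodic_def)

lemma take_periodic: "k \<le> k' \<Longrightarrow> take k (periodic k' u j) = periodic k u j"
  by (simp add: periodic_def take_map)

lemma periodic_mod: "periodic k u (j mod length u) = periodic k u j"
  by (simp add: periodic_def mod_simps)

lemma periodic_add: "periodic (k + k') u j = periodic k u j @ periodic k' u (j + k)"
  by (rule nth_equalityI) (auto simp: periodic_def nth_append)

lemma periodic_self: "periodic (length u) u 0 = u"
  by (rule nth_equalityI) (auto simp: periodic_def)

lemma set_periodic: "u \<noteq> [] \<Longrightarrow> set (periodic k u j) \<subseteq> set u"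
  by (auto simp: periodic_def)

definition rotations :: "nat \<Rightarrow> 'a list \<Rightarrow> 'a list set" where
  "rotations k u = range (periodic k u)"

lemma finite_rotations: "u \<noteq> [] \<Longrightarrow> finite (rotations k u)"
proof -
  assume "u \<noteq> []"
  have "rotations k u \<subseteq> periodic k u ` {..<length u}"
  proof
    fix x assume "x \<in> rotations k u"
    then obtain j where "x = periodic k u (j mod length u)" unfolding rotations_def periodic_mod by blast
    then show "x \<in> periodic k u ` {..<length u}" using \<open>u \<noteq> []\<close> by auto
  qed
  then show ?thesis using finite_subset by blast
qed

text \<open>
  Consider a stretch of indices on which the prefixes of length \<open>k = 3 ^ s\<close> of all \<open>R\<close> maxima are
  constant. A maximum attained in the stretch is a rotation of some \<open>u i\<close>. Its prefix of length
  \<open>3 k\<close> consists of its own constant \<open>k\<close>-prefix and of the \<open>k\<close>-prefixes of two further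
  rotations of \<open>u i\<close>. These are maxima at \<open>i\<close> as well, so each of the two prefixes is one of the
  \<open>R\<close> constant ones. A maximum that was attained before the stretch keeps the value that it has at
  the beginning of the stretch. So each coordinate takes at most \<open>R\<^sup>2 + 1\<close> values and the tuple
  at most \<open>R * R\<^sup>2 + 1 \<le> (R + 1) ^ 3\<close>. Stretching prefixes by the factor 3 is the best choice: a
  factor \<open>q\<close> costs \<open>n ^ q\<close> for each of \<open>log q n\<close> steps, and \<open>q / ln q\<close> is least for \<open>q = 3\<close> among
  the integers.
\<close>
lemma card_prefix_tuples:
  fixes u :: "nat \<Rightarrow> nat list" and L :: nat
  defines "V \<equiv> \<lambda>i. rotations L (u i)"
  assumes u: "\<And>i. u i \<noteq> []" and letters: "\<And>i. set (u i) \<subseteq> {..<l}" and "l > 0"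
    and no_chain: "\<And>i. i < M \<Longrightarrow> chain_ends V R i = {}"
    and "3 ^ s \<le> L"
  shows "card ((\<lambda>i. map (\<lambda>c. take (3 ^ s) (max_chain_end V c i)) [0..<R]) ` {..<M}) \<le> (Suc R * l) * (Suc R ^ 3) ^ s"
  using \<open>3 ^ s \<le> L\<close>
proof (induction s)
  have fin: "\<And>i. finite (V i)" unfolding V_def using u finite_rotations by blast
  case 0
  have "card ((\<lambda>i. take 1 (max_chain_end V c i)) ` {..<M}) \<le> Suc l" for c
  proof -
    have "take 1 (max_chain_end V c i) \<in> insert [] ((\<lambda>a. [a]) ` {..<l})" for i
    proof -
      consider "max_chain_end V c i = []" | i' where "max_chain_end V c i \<in> V i'"
        using max_chain_end_cases[of V c i, OF fin] by (auto simp: bot_list_def)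
      then show ?thesis
      proof cases
        case 2
        then obtain j where "max_chain_end V c i = periodic L (u i') j" by (auto simp: V_def rotations_def)
        then have *: "set (max_chain_end V c i) \<subseteq> {..<l}"
          using set_periodic[OF u, of L i' j] letters[of i'] by simp
        show ?thesis
        proof (cases "max_chain_end V c i")
          case (Cons a as)
          then show ?thesis using * by simp
        qed simp
      qed simp
    qed
    then have "card ((\<lambda>i. take 1 (max_chain_end V c i)) ` {..<M}) \<le> card (insert [] ((\<lambda>a. [a]) ` {..<l}))"
      by (intro card_mono image_subsetI) simp_all
    also have "\<dots> \<le> Suc l"
      using card_image_le[of "{..<l}" "\<lambda>a. [a]"] by (simp add: card_insert_if)
    finally show ?thesis .
  qed
  then have "card ((\<lambda>i. map (\<lambda>c. take 1 (max_chain_end V c i)) [0..<R]) ` {..<M}) \<le> Suc (R * l)"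
    by (intro card_monotone_tuples) (auto intro: take_mono_lex max_chain_end_mono[of V, OF fin])
  also have "\<dots> \<le> Suc R * l" using \<open>l > 0\<close> by simp
  finally show ?case by simp
next
  have fin: "\<And>i. finite (V i)" unfolding V_def using u finite_rotations by blast
  case (Suc s)
  define k :: nat where "k = 3 ^ s"
  have k3: "3 ^ Suc s = k + (k + k)" "k + (k + k) \<le> L" using Suc.prems by (auto simp: k_def)
  define state where "state i = map (\<lambda>c. take k (max_chain_end V c i)) [0..<R]" for i
  have state_nth: "state i ! c = take k (max_chain_end V c i)" if "c < R" for i c
    using that by (simp add: state_def)
  have "card ((\<lambda>i. map (\<lambda>c. take (k + (k + k)) (max_chain_end V c i)) [0..<R]) ` {..<M})
      \<le> (Suc R * l * (Suc R ^ 3) ^ s) * Suc R ^ 3"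
  proof (rule card_image_fibers)
    show "card (state ` {..<M}) \<le> Suc R * l * (Suc R ^ 3) ^ s"
      using Suc k3 by (simp add: state_def[abs_def] k_def)
    fix \<sigma> assume "\<sigma> \<in> state ` {..<M}"
    define J where "J = {i \<in> {..<M}. state i = \<sigma>}"
    have J_less: "i < M" and J_state: "state i = \<sigma>" if "i \<in> J" for i
      using that by (simp_all add: J_def)
    have J_nth: "take k (max_chain_end V c i) = \<sigma> ! c" if "i \<in> J" "c < R" for i c
      using state_nth[OF that(2), of i] J_state[OF that(1)] by simp
    have J: "finite J" "J \<noteq> {}" using \<open>\<sigma> \<in> state ` {..<M}\<close> by (auto simp: J_def)
    define i0 where "i0 = Min J"
    have i0: "i0 \<in> J" "\<And>i. i \<in> J \<Longrightarrow> i0 \<le> i" using J by (auto simp: i0_def)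
    \<comment> \<open>The maxima are monotone, so a stretch contains every index between two of its members.\<close>
    have convex: "i' \<in> J" if "i \<in> J" "i0 \<le> i'" "i' \<le> i" for i i'
    proof -
      have "take k (max_chain_end V c i') = take k (max_chain_end V c i)" if "c < R" for c
      proof (rule order_antisym)
        show "take k (max_chain_end V c i') \<le> take k (max_chain_end V c i)"
          using max_chain_end_mono[of V, OF fin \<open>i' \<le> i\<close>] by (rule take_mono_lex)
        have "take k (max_chain_end V c i) = take k (max_chain_end V c i0)"
          using J_nth[OF \<open>i \<in> J\<close> that] J_nth[OF i0(1) that] by simp
        then show "take k (max_chain_end V c i) \<le> take k (max_chain_end V c i')"
          using take_mono_lex[OF max_chain_end_mono[of V, OF fin \<open>i0 \<le> i'\<close>], of k c] by simp
      qed
      then have "state i' = state i" by (simp add: state_def)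
      then show ?thesis using J_state[OF \<open>i \<in> J\<close>] J_less[OF \<open>i \<in> J\<close>] \<open>i' \<le> i\<close> by (simp add: J_def)
    qed
    have block: "\<exists>c<R. periodic k (u i) j = \<sigma> ! c" if iJ: "i \<in> J" for i j
    proof -
      have "periodic L (u i) j \<in> V i" by (simp add: V_def rotations_def)
      then obtain c where "c < R" "max_chain_end V c i = periodic L (u i) j"
        using member_is_max_chain_end[of V, OF fin no_chain[OF J_less[OF iJ]]] by blast
      moreover have "take k (periodic L (u i) j) = periodic k (u i) j"
        using k3 by (intro take_periodic) simp
      ultimately show ?thesis using J_nth[OF iJ, of c] by metis
    qed
    have new: "take (k + (k + k)) (max_chain_end V c i) \<in> insert (take (k + (k + k)) (max_chain_end V c i0))
        ((\<lambda>(c', c''). \<sigma> ! c @ \<sigma> ! c' @ \<sigma> ! c'') ` ({..<R} \<times> {..<R}))"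
      if "c < R" "i \<in> J" for c i
    proof -
      have le: "max_chain_end V c i0 \<le> max_chain_end V c i" using max_chain_end_mono[of V, OF fin] i0 that by blast
      consider "max_chain_end V c i = bot" | i' where "i' \<le> i" "max_chain_end V c i \<in> V i'" "max_chain_end V c i' = max_chain_end V c i"
        using max_chain_end_cases[of V c i, OF fin] by blast
      then show ?thesis
      proof cases
        case 1
        then have "max_chain_end V c i0 = max_chain_end V c i" using le by (simp add: bot.extremum_unique)
        then show ?thesis by simp
      next
        \<comment> \<open>The index \<open>i'\<close> at which the maximum was attained lies in the stretch or before it.\<close>
        case (2 i')
        show ?thesis
        proof (cases "i0 \<le> i'")
          case True
          then have i'J: "i' \<in> J" using convex that 2 by blast
          obtain j where j: "max_chain_end V c i = periodic L (u i') j"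
            using 2 by (auto simp: V_def rotations_def)
          have "periodic k (u i') j = \<sigma> ! c"
            using J_nth[OF i'J \<open>c < R\<close>] 2 j k3 by (simp add: take_periodic)
          moreover have "take (k + (k + k)) (max_chain_end V c i)
              = periodic k (u i') j @ periodic k (u i') (j + k) @ periodic k (u i') (j + k + k)"
            using k3 j take_periodic[of "k + (k + k)" L "u i'" j]
              periodic_add[of k "k + k" "u i'" j] periodic_add[of k k "u i'" "j + k"] by simp
          moreover obtain c' c'' where "c' < R" "c'' < R" "periodic k (u i') (j + k) = \<sigma> ! c'"
            "periodic k (u i') (j + k + k) = \<sigma> ! c''"
            using block[OF i'J] by metis
          ultimately show ?thesis by auto
        next
          case False
          then have "max_chain_end V c i \<le> max_chain_end V c i0" using 2(3) max_chain_end_mono[of V, OF fin, of i' i0 c] by simp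
          then show ?thesis using le by simp
        qed
      qed
    qed
    have "card ((\<lambda>i. map (\<lambda>c. take (k + (k + k)) (max_chain_end V c i)) [0..<R]) ` J) \<le> Suc (R * (R * R))"
    proof (intro card_monotone_tuples)
      fix c assume "c < R"
      let ?N = "(\<lambda>(c', c''). \<sigma> ! c @ \<sigma> ! c' @ \<sigma> ! c'') ` ({..<R} \<times> {..<R})"
      have "card ((\<lambda>i. take (k + (k + k)) (max_chain_end V c i)) ` J)
          \<le> card (insert (take (k + (k + k)) (max_chain_end V c i0)) ?N)"
        using new[OF \<open>c < R\<close>] by (intro card_mono) auto
      also have "\<dots> \<le> Suc (card ?N)" by (simp add: card_insert_if)
      also have "\<dots> \<le> Suc (R * R)"
        using card_image_le[of "{..<R} \<times> {..<R}" "\<lambda>(c', c''). \<sigma> ! c @ \<sigma> ! c' @ \<sigma> ! c''"] by simp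
      finally show "card ((\<lambda>i. take (k + (k + k)) (max_chain_end V c i)) ` J) \<le> Suc (R * R)" .
    qed (auto intro: take_mono_lex max_chain_end_mono[of V, OF fin] J)
    also have "\<dots> \<le> Suc R ^ 3" by (simp add: power3_eq_cube algebra_simps)
    finally show "card ((\<lambda>i. map (\<lambda>c. take (k + (k + k)) (max_chain_end V c i)) [0..<R]) ` {i \<in> {..<M}. state i = \<sigma>})
        \<le> Suc R ^ 3" by (simp add: J_def)
  qed simp
  then show ?case unfolding k3(1) by (simp only: power_Suc mult.assoc mult.commute[of "Suc R ^ 3"])
qed

section \<open>Divisible words\<close>

text \<open>
  The words differ at a position that exists in both. Unlike the lexicographic order, which
  also compares a word with its prefixes, this relation survives appending arbitrary letters to both words.
\<close>
definition dominates :: "nat list \<Rightarrow> nat list \<Rightarrow> bool" where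
  "dominates a b \<longleftrightarrow> (\<exists>p x y a' b'. a = p @ x # a' \<and> b = p @ y # b' \<and> y < x)"

definition n_divisible :: "nat \<Rightarrow> nat list \<Rightarrow> bool" where
  "n_divisible n w \<longleftrightarrow> (\<exists>w0 ws. w = w0 @ concat ws \<and> length ws = n \<and> sorted_wrt dominates ws)"

lemma dominates_append: "dominates a b \<Longrightarrow> dominates (a @ r) (b @ s)"
  unfolding dominates_def by fastforce

lemma dominates_of_less: 
  assumes "length a = length b" "b < a" shows "dominates a b"
proof -
  have "(b, a) \<in> lexord {(x, y). x < y}" using assms(2) by (simp add: list_less_def)
  then consider x v where "a = b @ x # v"
    | p x y b' a' where "b = p @ x # b'" "a = p @ y # a'" "x < y"
    unfolding lexord_def by blast
  then show ?thesis
  proof cases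
    case 1
    then show ?thesis using assms(1) by simp
  next
    case 2
    then show ?thesis unfolding dominates_def by blast
  qed
qed

lemma append_less_append_iff [simp]: "a @ x < a @ y \<longleftrightarrow> x < (y :: nat list)"
  by (induction a) auto

lemma less_of_dominates: "dominates a b \<Longrightarrow> b < a"
  unfolding dominates_def by auto

lemma less_append:
  "length a = length b \<Longrightarrow> (b :: nat list) < a \<Longrightarrow> b @ s < a @ r"
  by (rule less_of_dominates, rule dominates_append, rule dominates_of_less)

lemma n_divisible_append_left: "n_divisible n w \<Longrightarrow> n_divisible n (v @ w)"
  unfolding n_divisible_def by (elim exE conjE, rule_tac x = "v @ w0" in exI) auto

text \<open>
  The blocks cut out between consecutive positions have at least \<open>m\<close> letters, so comparing the
  windows of \<open>m\<close> letters at the positions already compares the blocks.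
\<close>
lemma n_divisibleI:
  assumes gap: "\<And>i. Suc i < n \<Longrightarrow> pos i + m \<le> pos (Suc i)"
    and inside: "\<And>i. i < n \<Longrightarrow> pos i + m \<le> length w"
    and dec: "\<And>i. Suc i < n \<Longrightarrow> take m (drop (pos (Suc i)) w) < take m (drop (pos i) w)"
  shows "n_divisible n w"
proof -
  \<comment> \<open>The last block extends to the end of \<open>w\<close>.\<close>
  define q where "q i = (if i < n then pos i else length w)" for i
  define piece where "piece i = take (q (Suc i) - q i) (drop (q i) w)" for i
  have step: "q i + m \<le> q (Suc i)" if "i < n" for i
    using gap[of i] inside[of i] that by (simp add: q_def)
  have "take (q k) w = take (q 0) w @ concat (map piece [0..<k])" if "k \<le> n" for k
    using that
  proof (induction k)
    case (Suc k)
    have "take (q (Suc k)) w = take (q k + (q (Suc k) - q k)) w" using step[of k] Suc by simp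
    also have "\<dots> = take (q k) w @ piece k" by (simp only: take_add piece_def)
    finally show ?case using Suc by simp
  qed simp
  from this[of n] have "w = take (q 0) w @ concat (map piece [0..<n])" by (simp add: q_def)
  moreover have "sorted_wrt dominates (map piece [0..<n])"
  proof -
    have less: "take m (drop (pos j) w) < take m (drop (pos i) w)" if "i < j" "j < n" for i j
      using that
    proof (induction j)
      case (Suc j)
      then show ?case using dec[of j] by (cases "i = j") (auto intro: less_trans)
    qed simp
    have piece: "piece i = take m (drop (pos i) w) @ take (q (Suc i) - q i - m) (drop m (drop (pos i) w))"
      if "i < n" for i
    proof -
      have "q (Suc i) - q i = m + (q (Suc i) - q i - m)" using step[OF that] by simp
      then have "piece i = take (m + (q (Suc i) - q i - m)) (drop (q i) w)" by (simp add: piece_def)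
      then show ?thesis using that by (simp only: take_add q_def if_True)
    qed
    have "dominates (piece i) (piece j)" if "i < j" "j < n" for i j
    proof -
      have "i < n" using that by simp
      show ?thesis unfolding piece[OF \<open>i < n\<close>] piece[OF \<open>j < n\<close>]
        using inside[OF \<open>i < n\<close>] inside[OF \<open>j < n\<close>] less[OF that]
        by (intro dominates_append dominates_of_less) simp_all
    qed
    then show ?thesis by (simp add: sorted_wrt_iff_nth_less)
  qed
  ultimately show ?thesis unfolding n_divisible_def
    by (intro exI[of _ "take (q 0) w"] exI[of _ "map piece [0..<n]"]) simp
qed

section \<open>Words with highly periodic fragments\<close>

lemma take_periodic_window:
  assumes "take k x = periodic k u 0" "j + m \<le> k"
  shows "take m (drop j x) = periodic m u j"
proof -
  have "take m (drop j x) = take m (drop j (take k x))" using assms(2) by (simp add: drop_take)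
  also have "\<dots> = take m (drop j (periodic (j + (k - j)) u 0))" using assms by simp
  also have "\<dots> = take m (periodic (k - j) u j)" by (simp only: periodic_add) simp
  also have "\<dots> = periodic m u j" using assms(2) by (simp add: take_periodic)
  finally show ?thesis .
qed

lemma periodic_add_multiple: "periodic k u (c * length u + j) = periodic k u j"
  using periodic_mod[of k u "c * length u + j"] periodic_mod[of k u j] by simp

lemma concat_replicate_periodic: "concat (replicate k u) = periodic (k * length u) u 0"
proof (induction k)
  case (Suc k)
  have "periodic (Suc k * length u) u 0 = periodic (length u) u 0 @ periodic (k * length u) u (1 * length u + 0)"
    by (simp add: periodic_add)
  then show ?case unfolding periodic_add_multiple periodic_self using Suc by simp
qed (simp add: periodic_def)

lemma increasing_enumeration:
  assumes "finite I" "n \<le> card I"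
  obtains i :: "nat \<Rightarrow> nat" where "\<And>m. m < n \<Longrightarrow> i m \<in> I" "\<And>m. Suc m < n \<Longrightarrow> i m < i (Suc m)"
proof
  let ?xs = "sorted_list_of_set I"
  have len: "length ?xs = card I" by simp
  show "?xs ! m \<in> I" if "m < n" for m
    using that assms nth_mem[of m ?xs] len by simp
  show "?xs ! m < ?xs ! Suc m" if "Suc m < n" for m
    using that assms len sorted_wrt_nth_less[OF strict_sorted_list_of_set[of I], of m "Suc m"] by simp
qed

text \<open>
  Fragment \<open>i\<close> is an occurrence of \<open>u i ^ k i\<close> at position \<open>start i\<close> of \<open>w\<close>. It cannot be prolonged
  by another copy of \<open>u i\<close>. This is required only if another fragment follows, because then
  there are enough letters after fragment \<open>i\<close> to see how \<open>w\<close> deviates from the period.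
\<close>
locale periodic_fragments =
  fixes w :: "nat list" and M :: nat and start :: "nat \<Rightarrow> nat" and u :: "nat \<Rightarrow> nat list" and k :: "nat \<Rightarrow> nat"
    and n K :: nat
  assumes nonempty: "u i \<noteq> []"
    and short: "i < M \<Longrightarrow> length (u i) < n"
    and fragment: "i < M \<Longrightarrow> take (k i * length (u i)) (drop (start i) w) = periodic (k i * length (u i)) (u i) 0"
    and inside: "i < M \<Longrightarrow> start i + k i * length (u i) \<le> length w"
    and ordered: "Suc i < M \<Longrightarrow> start i + k i * length (u i) \<le> start (Suc i)"
    and long: "i < M \<Longrightarrow> K \<le> k i"
    and deviates: "Suc i < M \<Longrightarrow> take (length (u i)) (drop (start i + k i * length (u i)) w) \<noteq> u i"
begin

lemma ordered_less:
  "i < j \<Longrightarrow> j < M \<Longrightarrow> start i + k i * length (u i) \<le> start j"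
proof (induction j)
  case (Suc j)
  then show ?case using ordered[of j] by (cases "i = j") auto
qed simp

lemma window:
  assumes "i < M" "j + m \<le> k i * length (u i)"
  shows "take m (drop (start i + j) w) = periodic m (u i) j"
  using take_periodic_window[OF fragment[OF assms(1)] assms(2)] by (simp add: add.commute)

text \<open>
  The member with number \<open>c\<close> of a chain is placed at a distance of \<open>c * (L + 1)\<close> periods from the
  beginning of its fragment. Then the windows of \<open>L\<close> letters of consecutive members do not
  overlap, also when both lie in the same fragment, where the later rotation \<open>j\<close> may start up to one
  period earlier than the previous one.
\<close>
lemma chain_positions:
  assumes "x \<in> chain_ends (\<lambda>i. rotations L (u i)) c i" "i < M" "Suc c * Suc L \<le> K"
  shows "\<exists>i'\<le>i. \<exists>j<length (u i'). \<exists>pos. pos c = start i' + (c * Suc L * length (u i') + j) \<and>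
    periodic L (u i') j = x \<and>
    (\<forall>m<c. pos m + L \<le> pos (Suc m) \<and> take L (drop (pos (Suc m)) w) < take L (drop (pos m) w))"
  using assms
proof (induction c arbitrary: x i)
  case 0
  then obtain i' j where "i' \<le> i" "x = periodic L (u i') j" by (auto simp: rotations_def)
  moreover have "j mod length (u i') < length (u i')" using nonempty by simp
  ultimately show ?case using periodic_mod by fastforce
next
  case (Suc c)
  from Suc.prems(1) obtain i' y where i': "i' \<le> i" "x \<in> rotations L (u i')"
    and y: "y \<in> chain_ends (\<lambda>i. rotations L (u i)) c i'" "x < y" by auto
  have "i' < M" using i' Suc.prems by simp
  moreover have "Suc c * Suc L \<le> K" using Suc.prems(3) by simp
  ultimately obtain i0 j0 pos where i0: "i0 \<le> i'" "j0 < length (u i0)"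
    and pos: "pos c = start i0 + (c * Suc L * length (u i0) + j0)" "periodic L (u i0) j0 = y"
      "\<And>m. m < c \<Longrightarrow> pos m + L \<le> pos (Suc m) \<and> take L (drop (pos (Suc m)) w) < take L (drop (pos m) w)"
    using Suc.IH[OF y(1)] by blast
  obtain j' where "x = periodic L (u i') j'" using i'(2) by (auto simp: rotations_def)
  then obtain j where j: "j < length (u i')" "periodic L (u i') j = x"
    using periodic_mod[of L "u i'" j'] nonempty[of i'] by (metis length_greater_0_conv mod_less_divisor)
  \<comment> \<open>The new member is the rotation \<open>j\<close> after \<open>Suc c * Suc L\<close> periods of fragment \<open>i'\<close>.\<close>
  define pos' where "pos' = pos(Suc c := start i' + (Suc c * Suc L * length (u i') + j))"
  have fits: "b * Suc L * length (u a) + i + L \<le> k a * length (u a)"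
    if "a < M" "i < length (u a)" "b \<le> Suc c" for a b i
  proof -
    have "b * Suc L * length (u a) + i + L \<le> Suc c * Suc L * length (u a) + length (u a) + L * length (u a)"
      using that by (intro add_mono mult_mono) (auto simp: Suc_le_eq)
    also have "\<dots> = Suc (Suc c) * Suc L * length (u a)" by (simp add: algebra_simps)
    also have "\<dots> \<le> k a * length (u a)"
      using Suc.prems(3) long[OF that(1)] by (intro mult_mono) auto
    finally show ?thesis .
  qed
  have "i0 < M" using i0 \<open>i' < M\<close> by simp
  have word_c: "take L (drop (pos c) w) = y"
    using window[OF \<open>i0 < M\<close> fits[OF \<open>i0 < M\<close> i0(2), of c]] pos(1,2) periodic_add_multiple[of L "u i0" "c * Suc L" j0] by simp
  have word_Suc: "take L (drop (pos' (Suc c)) w) = x"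
    using window[OF \<open>i' < M\<close> fits[OF \<open>i' < M\<close> j(1), of "Suc c"]] j(2) periodic_add_multiple[of L "u i'" "Suc c * Suc L" j]
    by (simp add: pos'_def)
  have gap: "pos c + L \<le> pos' (Suc c)"
  proof (cases "i0 = i'")
    case True
    have "L \<le> L * length (u i')" using nonempty[of i'] by (simp add: Suc_le_eq)
    then have "j0 + L \<le> length (u i') + L * length (u i') + j" using i0(2) unfolding True by linarith
    then show ?thesis unfolding pos(1) pos'_def using True by (simp add: algebra_simps)
  next
    case False
    then have "start i0 + k i0 * length (u i0) \<le> start i'" using i0 \<open>i' < M\<close> ordered_less by simp
    then show ?thesis using fits[OF \<open>i0 < M\<close> i0(2), of c] pos(1) by (simp add: pos'_def)
  qed
  have "pos' m + L \<le> pos' (Suc m) \<and> take L (drop (pos' (Suc m)) w) < take L (drop (pos' m) w)" if "m < Suc c" for m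
  proof (cases "m = c")
    case True
    then show ?thesis using gap word_c word_Suc y(2) by (simp add: pos'_def)
  next
    case False
    then show ?thesis using pos(3)[of m] that by (simp add: pos'_def)
  qed
  then show ?case using i'(1) j by (intro exI[of _ i'] conjI exI[of _ j] exI[of _ pos']) (auto simp: pos'_def)
qed

lemma chain_ends_empty:
  assumes "\<not> n_divisible n w" "n > 0" "i < M" "n * Suc L \<le> K"
  shows "chain_ends (\<lambda>i. rotations L (u i)) (n - 1) i = {}"
proof (rule ccontr)
  assume "\<not> ?thesis"
  then obtain x where x: "x \<in> chain_ends (\<lambda>i. rotations L (u i)) (n - 1) i" by blast
  obtain i' j pos where *: "i' \<le> i" "j < length (u i')" "pos (n - 1) = start i' + ((n - 1) * Suc L * length (u i') + j)"
    "\<And>m. m < n - 1 \<Longrightarrow> pos m + L \<le> pos (Suc m) \<and> take L (drop (pos (Suc m)) w) < take L (drop (pos m) w)"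
    using chain_positions[OF x \<open>i < M\<close>] assms(2,4) by auto
  have "i' < M" using * assms by simp
  have last: "pos (n - 1) + L \<le> length w"
  proof -
    have "(n - 1) * Suc L * length (u i') + j + L \<le> (n - 1) * Suc L * length (u i') + length (u i') + L * length (u i')"
      using *(2) by (intro add_mono) (auto simp: Suc_le_eq)
    also have "\<dots> = (n - 1 + 1) * Suc L * length (u i')" by (simp add: algebra_simps)
    also have "\<dots> \<le> k i' * length (u i')" using assms long[OF \<open>i' < M\<close>] by (intro mult_mono) auto
    finally show ?thesis using inside[OF \<open>i' < M\<close>] *(3) by simp
  qed
  have le_last: "pos m \<le> pos (n - 1)" if "m \<le> n - 1" for m
    using that
  proof (induction rule: inc_induct)
    case (step m)
    then show ?case using *(4)[of m] by simp
  qed simp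
  have inside: "pos m + L \<le> length w" if "m < n" for m
  proof -
    have "m \<le> n - 1" using that by simp
    then show ?thesis using last le_last[of m] by simp
  qed
  have "n_divisible n w"
  proof (rule n_divisibleI[of n pos L])
    fix m
    show "m < n \<Longrightarrow> pos m + L \<le> length w" by (rule inside)
    assume "Suc m < n"
    then have "m < n - 1" by simp
    then show "pos m + L \<le> pos (Suc m)" "take L (drop (pos (Suc m)) w) < take L (drop (pos m) w)"
      using *(4) by simp_all
  qed
  then show False using assms(1) by simp
qed

text \<open>
  In the fragments \<open>i m\<close>, all of them powers of \<open>v\<close>, consider the windows that show the last \<open>q m\<close>
  copies of \<open>v\<close> and the letters that follow. The windows have \<open>n + 1\<close> periods, so at least one period
  after the fragment is visible when \<open>q m \<le> n\<close>.
\<close>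
lemma repetitions_divisible:
  assumes idx: "\<And>m. m < n \<Longrightarrow> Suc (i m) < M" "\<And>m. m < n \<Longrightarrow> u (i m) = v" "\<And>m. Suc m < n \<Longrightarrow> i m < i (Suc m)"
    and q: "\<And>m. m < n \<Longrightarrow> q m \<le> n"
    and big: "Suc n * n \<le> K" "2 * n + 1 \<le> K"
    and dec: "\<And>m. Suc m < n \<Longrightarrow>
       periodic (q (Suc m) * length v) v 0 @ take ((Suc n - q (Suc m)) * length v) (drop (start (i (Suc m)) + k (i (Suc m)) * length v) w)
     < periodic (q m * length v) v 0 @ take ((Suc n - q m) * length v) (drop (start (i m) + k (i m) * length v) w)"
  shows "n_divisible n w"
proof -
  define pos where "pos m = start (i m) + (k (i m) - q m) * length v" for m
  have facts: "i m < M" "q m \<le> k (i m)" "length v < n" "Suc n \<le> k (i m) - q m" if "m < n" for m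
    using idx(1,2)[OF that] q[OF that] big(2) long[of "i m"] short[of "i m"] by auto
  have word: "take (Suc n * length v) (drop (pos m) w) = periodic (q m * length v) v 0 @
      take ((Suc n - q m) * length v) (drop (start (i m) + k (i m) * length v) w)" if "m < n" for m
  proof -
    have e1: "Suc n * length v = q m * length v + (Suc n - q m) * length v"
      using q[OF that] by (simp flip: add_mult_distrib)
    have e2: "take (q m * length v) (drop (pos m) w) = periodic (q m * length v) v 0"
    proof -
      have "(k (i m) - q m) * length v + q m * length v \<le> k (i m) * length v"
        using facts(2)[OF that] by (simp flip: add_mult_distrib)
      then show ?thesis using window[OF facts(1)[OF that], of "(k (i m) - q m) * length v" "q m * length v"]
        periodic_add_multiple[of _ v _ 0] idx(2)[OF that] by (simp add: pos_def)
    qed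
    have e3: "q m * length v + pos m = start (i m) + k (i m) * length v"
      using facts(2)[OF that] by (simp add: pos_def flip: add_mult_distrib)
    show ?thesis unfolding e1 take_add drop_drop e2 e3 ..
  qed
  have cut: "(k (i m) - q m) * length v \<le> k (i m) * length v" for m
    by (intro mult_le_mono1) simp
  have tail: "pos m + Suc n * length v \<le> start (Suc (i m)) + Suc n * length v" if "m < n" for m
    using ordered[OF idx(1)[OF that], unfolded idx(2)[OF that]] cut[of m] unfolding pos_def by linarith
  have short_v: "Suc n * length v \<le> K" if "m < n" for m
    using facts(3)[OF that] big(1) mult_le_mono2[of "length v" n "Suc n"] by linarith
  show ?thesis
  proof (rule n_divisibleI[of n pos "Suc n * length v"])
    fix m assume m: "Suc m < n"
    then have m': "m < n" by simp
    have "pos m \<le> start (i m) + k (i m) * length (u (i m))"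
      using cut[of m] unfolding pos_def idx(2)[OF m'] by linarith
    also have "\<dots> \<le> start (i (Suc m))" using ordered_less[OF idx(3)[OF m] facts(1)[OF m]] .
    finally have "pos m \<le> start (i (Suc m))" .
    moreover have "Suc n * length v \<le> (k (i (Suc m)) - q (Suc m)) * length v"
      using facts(4)[OF m] by (intro mult_le_mono1)
    ultimately show "pos m + Suc n * length v \<le> pos (Suc m)" unfolding pos_def[of "Suc m"] by simp
    show "take (Suc n * length v) (drop (pos (Suc m)) w) < take (Suc n * length v) (drop (pos m) w)"
      unfolding word[OF m] word[OF m'] by (rule dec[OF m])
  next
    fix m assume m: "m < n"
    have "Suc n * length v \<le> k (Suc (i m)) * length (u (Suc (i m)))"
    proof -
      have "Suc n * length v \<le> k (Suc (i m)) * 1" using short_v[OF m] long[OF idx(1)[OF m]] by simp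
      also have "\<dots> \<le> k (Suc (i m)) * length (u (Suc (i m)))"
        using nonempty[of "Suc (i m)"] by (intro mult_le_mono2) (simp add: Suc_le_eq)
      finally show ?thesis .
    qed
    then show "pos m + Suc n * length v \<le> length w"
      using tail[OF m] inside[OF idx(1)[OF m]] by linarith
  qed
qed

text \<open>
  Let \<open>r\<close> be the word of length \<open>|v|\<close> that follows the fragment. If \<open>r < v\<close>, then
  \<open>v ^ q r ...\<close> is smaller than every word that begins with \<open>v ^ (q + 1)\<close>, so showing
  \<open>n, n - 1, ..., 1\<close> copies of \<open>v\<close> in successive fragments yields decreasing windows. If
  \<open>r > v\<close>, then \<open>1, 2, ..., n\<close> copies do the same.
\<close>
lemma repetitions_bound:
  assumes "\<not> n_divisible n w" "n > 0" and big: "Suc n * n \<le> K" "2 * n + 1 \<le> K"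
  shows "card {i. Suc i < M \<and> u i = v} \<le> 2 * (n - 1)"
proof -
  define rest where "rest i = take (length v) (drop (start i + k i * length v) w)" for i
  define I where "I = {i. Suc i < M \<and> u i = v}"
  have "finite I" by (rule finite_subset[of _ "{..<M}"]) (auto simp: I_def)
  have rest_take: "take (c * length v) (drop (start i + k i * length v) w)
      = rest i @ take ((c - 1) * length v) (drop (length v) (drop (start i + k i * length v) w))" if "c > 0" for i c
  proof -
    have "c * length v = length v + (c - 1) * length v" using that by (cases c) auto
    then show ?thesis unfolding rest_def by (simp only: take_add)
  qed
  have len_rest: "length (rest i) = length v" if "i \<in> I" for i
  proof -
    have "Suc i < M" "u i = v" using that by (auto simp: I_def)
    have "length v < n" using short[of i] \<open>Suc i < M\<close> \<open>u i = v\<close> by simp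
    moreover have "k (Suc i) * 1 \<le> k (Suc i) * length (u (Suc i))"
      using nonempty[of "Suc i"] by (intro mult_le_mono2) (simp add: Suc_le_eq)
    ultimately have "start i + k i * length v + length v \<le> length w"
      using big(2) ordered[OF \<open>Suc i < M\<close>, unfolded \<open>u i = v\<close>] inside[OF \<open>Suc i < M\<close>] long[OF \<open>Suc i < M\<close>]
      by linarith
    then show ?thesis by (simp add: rest_def)
  qed
  have pow: "periodic (Suc q * length v) v 0 = periodic (q * length v) v 0 @ v" for q
    using periodic_add[of "q * length v" "length v" v 0] periodic_add_multiple[of "length v" v q 0] periodic_self[of v]
    by (simp add: add.commute)
  \<comment> \<open>Fragments followed by a smaller word: the number of visible copies decreases.\<close>
  have lower: "card {i \<in> I. rest i < v} \<le> n - 1"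
  proof (rule ccontr)
    assume "\<not> ?thesis"
    then have many: "n \<le> card {i \<in> I. rest i < v}" by simp
    obtain i where i: "\<And>m. m < n \<Longrightarrow> i m \<in> {i \<in> I. rest i < v}" "\<And>m. Suc m < n \<Longrightarrow> i m < i (Suc m)"
      using \<open>finite I\<close> by (rule increasing_enumeration[OF finite_subset many, rotated]) blast+
    have "n_divisible n w"
    proof (rule repetitions_divisible[of i v "\<lambda>m. n - m"])
      fix m assume m: "Suc m < n"
      then have e: "n - m = Suc (n - Suc m)" by simp
      have "rest (i (Suc m)) < v" "length (rest (i (Suc m))) = length v" using i(1)[OF m] len_rest by auto
      then show "periodic ((n - Suc m) * length v) v 0 @ take ((Suc n - (n - Suc m)) * length v) (drop (start (i (Suc m)) + k (i (Suc m)) * length v) w)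
         < periodic ((n - m) * length v) v 0 @ take ((Suc n - (n - m)) * length v) (drop (start (i m) + k (i m) * length v) w)"
        unfolding e pow append_assoc append_less_append_iff using m
        by (subst rest_take) (auto intro!: less_append)
    qed (use i big in \<open>auto simp: I_def\<close>)
    then show False using assms(1) by simp
  qed
  \<comment> \<open>Fragments followed by a greater word: the number of visible copies increases.\<close>
  have upper: "card {i \<in> I. v < rest i} \<le> n - 1"
  proof (rule ccontr)
    assume "\<not> ?thesis"
    then have many: "n \<le> card {i \<in> I. v < rest i}" by simp
    obtain i where i: "\<And>m. m < n \<Longrightarrow> i m \<in> {i \<in> I. v < rest i}" "\<And>m. Suc m < n \<Longrightarrow> i m < i (Suc m)"
      using \<open>finite I\<close> by (rule increasing_enumeration[OF finite_subset many, rotated]) blast+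
    have "n_divisible n w"
    proof (rule repetitions_divisible[of i v Suc])
      fix m assume m: "Suc m < n"
      then have m': "m < n" by simp
      have "v < rest (i m)" "length (rest (i m)) = length v" using i(1)[OF m'] len_rest by auto
      then show "periodic (Suc (Suc m) * length v) v 0 @ take ((Suc n - Suc (Suc m)) * length v) (drop (start (i (Suc m)) + k (i (Suc m)) * length v) w)
         < periodic (Suc m * length v) v 0 @ take ((Suc n - Suc m) * length v) (drop (start (i m) + k (i m) * length v) w)"
        unfolding pow[of "Suc m"] append_assoc append_less_append_iff using m
        by (subst rest_take[of "Suc n - Suc m"]) (auto intro!: less_append)
    qed (use i big in \<open>auto simp: I_def\<close>)
    then show False using assms(1) by simp
  qed
  have "I = {i \<in> I. rest i < v} \<union> {i \<in> I. v < rest i}"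
    using deviates by (force simp: I_def rest_def)
  then have "card I \<le> card {i \<in> I. rest i < v} + card {i \<in> I. v < rest i}"
    by (metis card_Un_le)
  then show ?thesis using lower upper by (simp add: I_def)
qed

text \<open>
  Fragments are classified by the tuple of prefixes of the maximal chain ends, then by the word
  \<open>u i\<close>. The word itself is the rotation by \<open>0\<close>, so it is one of the maxima cut off after
  \<open>length (u i) < n\<close> letters, and the prefixes of length \<open>3 ^ t \<ge> n\<close> are long enough to show it.
\<close>
lemma fragments_bound:
  assumes "\<not> n_divisible n w" "n > 0" "l > 0" and letters: "\<And>i. set (u i) \<subseteq> {..<l}"
    and t: "n \<le> 3 ^ t" and big: "n * Suc (3 ^ t) \<le> K" "2 * n + 1 \<le> K"
  shows "M - 1 \<le> n * l * (n ^ 3) ^ t * ((n - 1) * (n - 1) * (2 * (n - 1)))"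
proof -
  define V where "V = (\<lambda>i. rotations (3 ^ t) (u i))"
  define state where "state i = map (\<lambda>c. take (3 ^ t) (max_chain_end V c i)) [0..<n - 1]" for i
  have fin: "\<And>i. finite (V i)" unfolding V_def using nonempty finite_rotations by blast
  have empty: "chain_ends V (n - 1) i = {}" if "i < M" for i
    unfolding V_def using chain_ends_empty[OF assms(1,2) that big(1)] .
  have n: "Suc (n - 1) = n" using \<open>n > 0\<close> by simp
  have big': "Suc n * n \<le> K" using big(1) t mult_le_mono2[of "Suc n" "Suc (3 ^ t)" n] by (simp only: mult.commute[of "Suc n"]) linarith
  have "card (id ` {..<M - 1}) \<le> n * l * (n ^ 3) ^ t * ((n - 1) * (n - 1) * (2 * (n - 1)))"
  proof (rule card_image_fibers)
    have "card (state ` {..<M}) \<le> n * l * (n ^ 3) ^ t"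
      using card_prefix_tuples[of u l M "3 ^ t" "n - 1" t, OF nonempty letters \<open>l > 0\<close>] empty n
      by (simp add: state_def[abs_def] V_def)
    moreover have "card (state ` {..<M - 1}) \<le> card (state ` {..<M})" by (intro card_mono image_mono) auto
    ultimately show "card (state ` {..<M - 1}) \<le> n * l * (n ^ 3) ^ t" by simp
  next
    fix \<sigma>
    let ?J = "{i \<in> {..<M - 1}. state i = \<sigma>}"
    show "card (id ` ?J) \<le> (n - 1) * (n - 1) * (2 * (n - 1))"
    proof (rule card_image_fibers)
      let ?P = "(\<lambda>(p, c). take p (\<sigma> ! c)) ` ({1..<n} \<times> {..<n - 1})"
      have "u i \<in> ?P" if "i \<in> ?J" for i
      proof -
        have i: "i < M" "state i = \<sigma>" using that by auto
        have "periodic (3 ^ t) (u i) 0 \<in> V i" by (simp add: V_def rotations_def)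
        then obtain c where c: "c < n - 1" "max_chain_end V c i = periodic (3 ^ t) (u i) 0"
          using member_is_max_chain_end[of V, OF fin empty[OF i(1)]] by blast
        have "take (length (u i)) (\<sigma> ! c) = take (length (u i)) (periodic (3 ^ t) (u i) 0)"
          using c i(2) by (auto simp: state_def)
        also have "\<dots> = u i" using short[OF i(1)] t by (simp add: take_periodic periodic_self)
        finally show ?thesis using c(1) short[OF i(1)] nonempty[of i]
          by (intro image_eqI[of _ _ "(length (u i), c)"]) (auto simp: Suc_le_eq)
      qed
      then have "card (u ` ?J) \<le> card ?P" by (intro card_mono image_subsetI) auto
      also have "\<dots> \<le> card ({1..<n} \<times> {..<n - 1})" by (intro card_image_le) auto
      finally show "card (u ` ?J) \<le> (n - 1) * (n - 1)" by simp
      fix v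
      have "card (id ` {i \<in> ?J. u i = v}) \<le> card {i. Suc i < M \<and> u i = v}"
        by (intro card_mono) (auto intro: finite_subset[of _ "{..<M}"])
      then show "card (id ` {i \<in> ?J. u i = v}) \<le> 2 * (n - 1)"
        using repetitions_bound[OF assms(1,2) big' big(2), of v] by simp
    qed simp
  qed simp
  then show ?thesis by simp
qed

end

section \<open>Decomposition of indivisible words\<close>

lemma equal_factors_periodic:
  assumes "0 < d" "o1 + d + m \<le> length v"
    and eq: "take m (drop o1 v) = take m (drop (o1 + d) v)"
  shows "take m (drop o1 v) = periodic m (take d (drop o1 v)) 0"
proof -
  define u where "u = take d (drop o1 v)"
  have len: "length u = d" using assms by (simp add: u_def)
  have "v ! (o1 + x) = u ! (x mod d)" if "x < d + m" for x
    using that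
  proof (induction x rule: less_induct)
    case (less x)
    show ?case
    proof (cases "x < d")
      case True
      then show ?thesis using assms by (simp add: u_def)
    next
      case False
      define y where "y = x - d"
      have y: "x = y + d" "y < m" using False less.prems by (auto simp: y_def)
      have "v ! (o1 + y) = take m (drop o1 v) ! y" using y assms(2) by simp
      also have "\<dots> = v ! (o1 + x)" unfolding eq using y assms(2) by (simp add: ac_simps)
      finally have "v ! (o1 + y) = v ! (o1 + x)" .
      then show ?thesis using less.IH[of y] y \<open>0 < d\<close> by simp
    qed
  qed
  then show ?thesis using assms(1,2) len by (intro nth_equalityI) (auto simp: periodic_def u_def[symmetric])
qed

text \<open>
  In a long word some block \<open>v\<close> of \<open>B\<close> letters occurs at \<open>n\<close> multiples of \<open>B\<close>. Compare the \<open>n\<close>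
  factors of \<open>v\<close> with \<open>m\<close> letters at the offsets \<open>0, ..., n - 1\<close>. If they are distinct, then the
  greatest one from the first copy of \<open>v\<close>, the next one from the second copy, and so on, make the
  word divisible. If two of them agree, then the difference \<open>d < n\<close> of their offsets is a period.
\<close>
lemma high_power_factor:
  fixes n l K :: nat
  assumes "n > 0"
  shows "\<exists>N. \<forall>w. set w \<subseteq> {..<l} \<longrightarrow> N \<le> length w \<longrightarrow> \<not> n_divisible n w \<longrightarrow>
    (\<exists>a u b. w = a @ concat (replicate K u) @ b \<and> u \<noteq> [] \<and> length u < n \<and> length a \<le> N)"
proof (rule exI, intro allI impI)
  define m where "m = K * n"
  \<comment> \<open>Windows with offset below \<open>n\<close> fit into a block, and those in different copies stay disjoint.\<close>
  define B where "B = m + n"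
  define C where "C = l ^ B * n + 1"
  fix w :: "nat list" assume w: "set w \<subseteq> {..<l}" "C * B \<le> length w" "\<not> n_divisible n w"
  define block where "block i = take B (drop (i * B) w)" for i
  have inside: "i * B + B \<le> length w" if "i < C" for i
    using w(2) mult_le_mono1[of "Suc i" C B] that by simp
  have len_block: "length (block i) = B" if "i < C" for i
    using inside[OF that] by (auto simp: block_def min_def)
  obtain v where v: "v \<in> block ` {..<C}" "n \<le> card {i \<in> {..<C}. block i = v}"
  proof (rule ccontr)
    assume none: "\<not> thesis"
    note that' = that
    have few: "card {i \<in> {..<C}. block i = v} \<le> n" if "v \<in> block ` {..<C}" for v
      using that'[OF that] none by (metis nat_le_linear)
    have "block ` {..<C} \<subseteq> {xs. set xs \<subseteq> {..<l} \<and> length xs = B}"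
      using w(1) len_block by (auto simp: block_def dest!: in_set_takeD in_set_dropD)
    then have "card (block ` {..<C}) \<le> l ^ B"
      using card_mono[OF finite_lists_length_eq[of "{..<l}" B]] card_lists_length_eq[of "{..<l}" B] by simp
    then have "card (id ` {..<C}) \<le> l ^ B * n"
      by (rule card_image_fibers[rotated]) (use few in simp_all)
    then show False by (simp add: C_def)
  qed
  have len_v: "length v = B" using v(1) len_block by auto
  define factor where "factor j = take m (drop j v)" for j
  have factor_in: "take m (drop (i * B + j) w) = factor j" if "block i = v" "j \<le> n" for i j
  proof -
    have "factor j = take m (take (B - j) (drop (i * B + j) w))"
      unfolding factor_def that(1)[symmetric] block_def by (simp add: drop_take add.commute)
    then show ?thesis using that(2) by (simp add: B_def)
  qed
  show "\<exists>a u b. w = a @ concat (replicate K u) @ b \<and> u \<noteq> [] \<and> length u < n \<and> length a \<le> C * B"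
  proof (cases "inj_on factor {..<n}")
    case True
    define fs where "fs = rev (sorted_list_of_set (factor ` {..<n}))"
    have fs: "length fs = n" "set fs = factor ` {..<n}" "sorted_wrt (>) fs"
      using True by (simp_all add: fs_def card_image sorted_wrt_rev)
    have "\<exists>j<n. factor j = fs ! k" if "k < n" for k
      using nth_mem[of k fs] fs that by auto
    then obtain off where off: "\<And>k. k < n \<Longrightarrow> off k < n \<and> factor (off k) = fs ! k" by metis
    have "finite {i \<in> {..<C}. block i = v}" by simp
    then obtain i where i: "\<And>k. k < n \<Longrightarrow> i k \<in> {i \<in> {..<C}. block i = v}" "\<And>k. Suc k < n \<Longrightarrow> i k < i (Suc k)"
      using increasing_enumeration[OF _ v(2)] by blast
    have "n_divisible n w"
    proof (rule n_divisibleI[of n "\<lambda>k. i k * B + off k" m])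
      fix k assume k: "Suc k < n"
      have "Suc (i k) * B \<le> i (Suc k) * B" using i(2)[OF k] by (intro mult_le_mono1) simp
      then show "i k * B + off k + m \<le> i (Suc k) * B + off (Suc k)"
        using off[of k] k by (simp add: B_def)
      have "fs ! Suc k < fs ! k" using fs(1,3) k sorted_wrt_nth_less by fastforce
      then show "take m (drop (i (Suc k) * B + off (Suc k)) w) < take m (drop (i k * B + off k) w)"
        using factor_in[of "i k" "off k"] factor_in[of "i (Suc k)" "off (Suc k)"] i(1)[of k] i(1)[of "Suc k"]
          off[of k] off[of "Suc k"] k by simp
    next
      fix k assume k: "k < n"
      then show "i k * B + off k + m \<le> length w"
        using inside[of "i k"] i(1)[OF k] off[OF k] by (simp add: B_def)
    qed
    then show ?thesis using w(3) by simp
  next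
    case False
    then obtain o1 o2 where o: "o1 < o2" "o2 < n" "factor o1 = factor o2"
      unfolding inj_on_def by (metis lessThan_iff linorder_neqE_nat)
    define d where "d = o2 - o1"
    define u where "u = take d (drop o1 v)"
    have d: "o2 = o1 + d" "0 < d" "d < n" using o by (auto simp: d_def)
    have u: "length u = d" using d o len_v by (simp add: u_def B_def)
    have "factor o1 = periodic m u 0"
      unfolding factor_def u_def using o d len_v by (intro equal_factors_periodic) (auto simp: factor_def B_def)
    moreover obtain i where i: "i < C" "block i = v" using v(1) by auto
    ultimately have eq: "take m (drop (i * B + o1) w) = periodic m u 0"
      using factor_in[of i o1] o by simp
    have "K * d \<le> m" using d by (simp add: m_def)
    then have "take (K * d) (drop (i * B + o1) w) = concat (replicate K u)"
      using take_periodic_window[OF eq, of 0 "K * d"] by (simp add: concat_replicate_periodic u)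
    then have "w = take (i * B + o1) w @ concat (replicate K u) @ drop (K * d) (drop (i * B + o1) w)"
      by (metis append_take_drop_id)
    moreover have "i * B + o1 \<le> C * B"
      using mult_le_mono1[of "Suc i" C B] i(1) o by (simp add: B_def)
    ultimately show ?thesis using u d by (metis length_greater_0_conv length_take min.coboundedI2 min.commute)
  qed
qed

text \<open>
  A triple \<open>(d, u, k)\<close> stands for the factor \<open>d u ^ k\<close>, and \<open>e\<close> is the rest after the last power.
\<close>
fun assemble :: "('a list \<times> 'a list \<times> nat) list \<Rightarrow> 'a list \<Rightarrow> 'a list" where
  "assemble [] e = e"
| "assemble ((d, u, k) # fs) e = d @ concat (replicate k u) @ assemble fs e"

text \<open>
  The gaps between the powers have at most \<open>N\<close> letters, and each power is extended to the right as
  far as possible.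
\<close>
fun greedy :: "nat \<Rightarrow> nat \<Rightarrow> nat \<Rightarrow> ('a list \<times> 'a list \<times> nat) list \<Rightarrow> 'a list \<Rightarrow> bool" where
  "greedy N n K [] e \<longleftrightarrow> length e \<le> N"
| "greedy N n K ((d, u, k) # fs) e \<longleftrightarrow> length d \<le> N \<and> u \<noteq> [] \<and> length u < n \<and> K \<le> k \<and>
     take (length u) (assemble fs e) \<noteq> u \<and> greedy N n K fs e"

lemma strip_powers:
  assumes "u \<noteq> []"
  shows "\<exists>k b'. b = concat (replicate k u) @ b' \<and> take (length u) b' \<noteq> u"
proof (induction b rule: length_induct)
  case (1 b)
  show ?case
  proof (cases "take (length u) b = u")
    case True
    then have b: "b = u @ drop (length u) b" by (metis append_take_drop_id)
    then have "length (drop (length u) b) < length b" using assms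
      by (metis length_append length_greater_0_conv less_add_same_cancel2)
    then obtain k b' where "drop (length u) b = concat (replicate k u) @ b'" "take (length u) b' \<noteq> u"
      using 1 by blast
    then have "b = concat (replicate (Suc k) u) @ b'" using b by simp
    then show ?thesis using \<open>take (length u) b' \<noteq> u\<close> by blast
  next
    case False
    then show ?thesis by (intro exI[of _ 0] exI[of _ b]) simp
  qed
qed

lemma greedy_decomposition:
  assumes "n > 0" "K > 0"
  shows "\<exists>N. \<forall>w. set w \<subseteq> {..<l} \<longrightarrow> \<not> n_divisible n w \<longrightarrow>
    (\<exists>fs e. w = assemble fs e \<and> greedy N n K fs e)"
proof -
  obtain N where N: "\<forall>w. set w \<subseteq> {..<l} \<longrightarrow> N \<le> length w \<longrightarrow> \<not> n_divisible n w \<longrightarrow>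
    (\<exists>a u b. w = a @ concat (replicate K u) @ b \<and> u \<noteq> [] \<and> length u < n \<and> length a \<le> N)"
    using high_power_factor[OF \<open>n > 0\<close>, of l K] by blast
  have "\<exists>fs e. w = assemble fs e \<and> greedy N n K fs e" if "set w \<subseteq> {..<l}" "\<not> n_divisible n w" for w
    using that
  proof (induction w rule: length_induct)
    case (1 w)
    show ?case
    proof (cases "N \<le> length w")
      case False
      then show ?thesis by (intro exI[of _ "[]"] exI[of _ w]) simp
    next
      case True
      obtain a u b where w: "w = a @ concat (replicate K u) @ b" "u \<noteq> []" "length u < n" "length a \<le> N"
        using N 1(2) True 1(3) by blast
      obtain k b' where b: "b = concat (replicate k u) @ b'" "take (length u) b' \<noteq> u"
        using strip_powers[OF w(2)] by blast
      have w': "w = a @ concat (replicate (K + k) u) @ b'"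
        using w(1) b(1) by (simp add: replicate_add)
      have "length b' < length w"
        using w(2) \<open>K > 0\<close> by (simp add: w' concat_replicate_periodic)
      moreover have "set b' \<subseteq> {..<l}" using 1(2) w' by simp
      moreover have "\<not> n_divisible n b'"
        using 1(3) n_divisible_append_left[of n b' "a @ concat (replicate (K + k) u)"] unfolding w' append_assoc by blast
      ultimately obtain fs e where "b' = assemble fs e" "greedy N n K fs e" using 1(1) by blast
      then have "w = assemble ((a, u, K + k) # fs) e \<and> greedy N n K ((a, u, K + k) # fs) e"
        using w w' b by simp
      then show ?thesis by blast
    qed
  qed
  then show ?thesis by blast
qed

lemma assemble_append: "assemble (fs @ gs) e = assemble fs [] @ assemble gs e"
  by (induction fs "[] :: 'a list" rule: assemble.induct) auto

lemma greedy_antimono: "greedy N n K fs e \<Longrightarrow> K' \<le> K \<Longrightarrow> greedy N n K' fs e"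
  by (induction N n K fs e rule: greedy.induct) auto

lemma greedy_nth:
  assumes "greedy N n K fs e" "i < length fs" "fs ! i = (d, u, k)"
  shows "u \<noteq> [] \<and> length u < n \<and> K \<le> k \<and> take (length u) (assemble (drop (Suc i) fs) e) \<noteq> u"
  using assms
proof (induction fs arbitrary: i)
  case (Cons f fs)
  then show ?case by (cases f; cases i) auto
qed simp

lemma set_assemble_nth: "(d, u, k) \<in> set fs \<Longrightarrow> k > 0 \<Longrightarrow> set u \<subseteq> set (assemble fs e)"
  by (induction fs e rule: assemble.induct) auto

text \<open>
  The last power is not counted by \<open>length fs - 1\<close>: after it too few letters may be left to
  deviate from the period.
\<close>
lemma greedy_length_bound:
  assumes "greedy N n K fs e" "set (assemble fs e) \<subseteq> {..<l}" "\<not> n_divisible n (assemble fs e)"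
    and "n > 0" "l > 0" "n \<le> 3 ^ t" "n * Suc (3 ^ t) \<le> K" "2 * n + 1 \<le> K"
  shows "length fs - 1 \<le> n * l * (n ^ 3) ^ t * ((n - 1) * (n - 1) * (2 * (n - 1)))"
proof -
  let ?w = "assemble fs e"
  define M where "M = length fs"
  define u where "u i = (if i < M then fst (snd (fs ! i)) else [0])" for i
  define k where "k i = snd (snd (fs ! i))" for i
  define start where "start i = length (assemble (take i fs) []) + length (fst (fs ! i))" for i
  have nth: "fs ! i = (fst (fs ! i), u i, k i)" if "i < M" for i
    using that by (simp add: u_def k_def)
  have split: "?w = assemble (take i fs) [] @ fst (fs ! i) @ concat (replicate (k i) (u i)) @ assemble (drop (Suc i) fs) e"
    if "i < M" for i
  proof -
    have "fs = take i fs @ fs ! i # drop (Suc i) fs" using that by (simp add: M_def id_take_nth_drop)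
    then have "?w = assemble (take i fs) [] @ assemble (fs ! i # drop (Suc i) fs) e"
      by (metis assemble_append)
    then show ?thesis using nth[OF that] by (metis assemble.simps(2))
  qed
  have drop_st: "drop (start i) ?w = concat (replicate (k i) (u i)) @ assemble (drop (Suc i) fs) e" if "i < M" for i
    by (subst split[OF that]) (simp add: start_def)
  have len: "length (concat (replicate (k i) (u i))) = k i * length (u i)" for i
    by (simp add: concat_replicate_periodic)
  have props: "u i \<noteq> [] \<and> length (u i) < n \<and> K \<le> k i \<and> take (length (u i)) (assemble (drop (Suc i) fs) e) \<noteq> u i"
    if "i < M" for i
    using greedy_nth[OF assms(1) _ nth[OF that]] that by (simp add: M_def)
  interpret periodic_fragments ?w M start u k n K
  proof
    show "u i \<noteq> []" for i using props[of i] by (cases "i < M") (auto simp: u_def)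
    fix i
    show "length (u i) < n" if "i < M" using props[OF that] by simp
    show "K \<le> k i" if "i < M" using props[OF that] by simp
    show "take (k i * length (u i)) (drop (start i) ?w) = periodic (k i * length (u i)) (u i) 0" if "i < M"
      unfolding drop_st[OF that] by (simp add: concat_replicate_periodic)
    show "start i + k i * length (u i) \<le> length ?w" if "i < M"
    proof -
      have "length ?w = start i + (k i * length (u i) + length (assemble (drop (Suc i) fs) e))"
        by (subst split[OF that]) (simp only: length_append len start_def add.assoc)
      then show ?thesis by simp
    qed
    show "start i + k i * length (u i) \<le> start (Suc i)" if "Suc i < M"
    proof -
      have i: "i < M" using that by simp
      have "take (Suc i) fs = take i fs @ [(fst (fs ! i), u i, k i)]"
        using i nth[OF i] by (simp add: M_def take_Suc_conv_app_nth)
      then show ?thesis by (simp add: start_def assemble_append len)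
    qed
    show "take (length (u i)) (drop (start i + k i * length (u i)) ?w) \<noteq> u i" if "Suc i < M"
    proof -
      have i: "i < M" using that by simp
      have "drop (start i + k i * length (u i)) ?w = drop (k i * length (u i)) (drop (start i) ?w)"
        by (simp add: add.commute)
      also have "\<dots> = assemble (drop (Suc i) fs) e" unfolding drop_st[OF i] by (simp add: len)
      finally show ?thesis using props[OF i] by simp
    qed
  qed
  have "set (u i) \<subseteq> {..<l}" for i
  proof (cases "i < M")
    case True
    have "set (u i) \<subseteq> set ?w"
      using True props[OF True] nth[OF True] assms(8) set_assemble_nth[of "fst (fs ! i)" "u i" "k i" fs e]
      by (metis M_def add_gr_0 less_le_trans nth_mem zero_less_one)
    then show ?thesis using assms(2) by simp
  qed (use \<open>l > 0\<close> in \<open>simp add: u_def\<close>)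
  then show ?thesis using fragments_bound[OF assms(3,4,5) _ assms(6,7,8)] by (simp add: M_def)
qed

lemma fragment_count_less:
  fixes n l t c :: nat
  assumes "n > 0" "l > 0" "c - 1 \<le> n * l * (n ^ 3) ^ t * ((n - 1) * (n - 1) * (2 * (n - 1)))"
  shows "c < 2 * n ^ (3 * t + 4) * l"
proof -
  define A where "A = 2 * l * n * (n ^ 3) ^ t"
  have A: "2 \<le> A" using assms by (simp add: A_def Suc_le_eq)
  have "c - 1 \<le> A * ((n - 1) * (n - 1) * (n - 1))" using assms(3) by (simp add: A_def ac_simps)
  moreover have "(n - 1) * (n - 1) * (n - 1) + 1 \<le> n ^ 3"
    using assms(1) by (cases n) (simp_all add: power3_eq_cube algebra_simps)
  then have "A * ((n - 1) * (n - 1) * (n - 1) + 1) \<le> A * n ^ 3" by (rule mult_le_mono2)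
  ultimately have "c < A * n ^ 3" using A by (simp add: algebra_simps)
  also have "\<dots> = 2 * n ^ (3 * t + 4) * l"
    unfolding A_def power_mult[symmetric] by (simp add: power_add eval_nat_numeral algebra_simps)
  finally show ?thesis .
qed

text \<open>
  The exponent \<open>K\<close> only has to be large enough for the windows used in \<open>chain_positions\<close> and
  \<open>repetitions_bound\<close> to fit into a fragment.
\<close>
lemma sparse_decomposition:
  fixes n l t :: nat
  assumes "n > 0" "l > 0" "n \<le> 3 ^ t"
  shows "\<exists>N. \<forall>w. set w \<subseteq> {..<l} \<longrightarrow> \<not> n_divisible n w \<longrightarrow>
    (\<exists>fs e. w = assemble fs e \<and> greedy N n 1 fs e \<and> length fs < 2 * n ^ (3 * t + 4) * l)"
proof -
  define K where "K = n * Suc (3 ^ t) + 2 * n + 1"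
  have "K > 0" by (simp add: K_def)
  obtain N where N: "\<forall>w. set w \<subseteq> {..<l} \<longrightarrow> \<not> n_divisible n w \<longrightarrow>
    (\<exists>fs e. w = assemble fs e \<and> greedy N n K fs e)"
    using greedy_decomposition[OF \<open>n > 0\<close> \<open>K > 0\<close>, of l] by blast
  have "\<exists>fs e. w = assemble fs e \<and> greedy N n 1 fs e \<and> length fs < 2 * n ^ (3 * t + 4) * l"
    if w: "set w \<subseteq> {..<l}" "\<not> n_divisible n w" for w
  proof -
    obtain fs e where fs: "w = assemble fs e" "greedy N n K fs e" using N w by blast
    have "length fs - 1 \<le> n * l * (n ^ 3) ^ t * ((n - 1) * (n - 1) * (2 * (n - 1)))"
      using w fs assms by (intro greedy_length_bound[of N n K fs e l t]) (auto simp: K_def)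
    then have "length fs < 2 * n ^ (3 * t + 4) * l" by (rule fragment_count_less[OF assms(1,2)])
    moreover have "greedy N n 1 fs e" using fs(2) by (rule greedy_antimono) (simp add: K_def)
    ultimately show ?thesis using fs(1) by blast
  qed
  then show ?thesis by blast
qed

section \<open>The multilinear consequence of an identity\<close>

lemma list_prod_Cons: "xs \<noteq> [] \<Longrightarrow> list_prod (x # xs) = x * list_prod xs"
  by (cases xs) auto

lemma list_prod_append:
  "xs \<noteq> [] \<Longrightarrow> ys \<noteq> [] \<Longrightarrow> list_prod (xs @ ys) = list_prod xs * list_prod ys"
  by (induction xs rule: list_nonempty_induct) (simp_all add: list_prod_Cons mult.assoc)

lemma list_prod_concat:
  "ws \<noteq> [] \<Longrightarrow> [] \<notin> set ws \<Longrightarrow> list_prod (concat ws) = list_prod (map list_prod ws)"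
proof (induction ws rule: list_nonempty_induct)
  case (cons w ws)
  then have "concat ws \<noteq> []" by (cases ws) auto
  moreover have "w \<noteq> []" using cons(3) by auto
  ultimately show ?case using cons by (simp add: list_prod_append list_prod_Cons)
qed simp

text \<open>
  If \<open>g j\<close> is the variable for which \<open>y j\<close> is a possible summand, these are the ways to select a
  summand for each letter of \<open>v\<close> when the product of sums is expanded.
\<close>
definition choices :: "nat set \<Rightarrow> (nat \<Rightarrow> 'b) \<Rightarrow> 'b list \<Rightarrow> nat list set" where
  "choices S g v = {js. set js \<subseteq> S \<and> map g js = v}"

lemma choices_Cons:
  "choices S g (i # v) = (\<lambda>(j, js). j # js) ` ({j \<in> S. g j = i} \<times> choices S g v)"
  by (force simp: choices_def map_eq_Cons_conv)

lemma finite_choices: "finite S \<Longrightarrow> finite (choices S g v)"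
  by (rule finite_subset[OF _ finite_lists_length_eq[of S "length v"]]) (auto simp: choices_def)

lemma list_prod_of_sums:
  assumes "v \<noteq> []" "finite S"
  shows "list_prod (map (\<lambda>i. \<Sum>j | j \<in> S \<and> g j = i. y j) v) = (\<Sum>js\<in>choices S g v. list_prod (map y js))"
  using assms(1)
proof (induction v rule: list_nonempty_induct)
  case (single i)
  have "choices S g [i] = (\<lambda>j. [j]) ` {j. j \<in> S \<and> g j = i}"
    by (force simp: choices_def map_eq_Cons_conv)
  then show ?case by (simp add: sum.reindex inj_on_def)
next
  case (cons i v)
  have nonempty: "js \<noteq> []" if "js \<in> choices S g v" for js
    using that cons(1) by (auto simp: choices_def)
  have "inj_on (\<lambda>(j, js). j # js) ({j \<in> S. g j = i} \<times> choices S g v)"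
    by (auto simp: inj_on_def)
  then have "(\<Sum>js\<in>choices S g (i # v). list_prod (map y js))
      = (\<Sum>(j, js)\<in>{j \<in> S. g j = i} \<times> choices S g v. list_prod (map y (j # js)))"
    unfolding choices_Cons by (subst sum.reindex) (auto simp: case_prod_unfold)
  also have "\<dots> = (\<Sum>(j, js)\<in>{j \<in> S. g j = i} \<times> choices S g v. y j * list_prod (map y js))"
    using nonempty by (intro sum.cong) (auto simp: list_prod_Cons)
  also have "\<dots> = (\<Sum>j | j \<in> S \<and> g j = i. y j) * (\<Sum>js\<in>choices S g v. list_prod (map y js))"
    by (simp add: sum_product sum.cartesian_product)
  finally show ?case using cons by (simp add: list_prod_Cons)
qed

lemma alternating_sum_supersets:
  assumes "finite U" "T \<subseteq> U"
  shows "(\<Sum>S | S \<subseteq> U \<and> T \<subseteq> S. (- 1) ^ card S) = (if T = U then (- 1) ^ card U else (0 :: 'b::ring_1))"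
proof (cases "T = U")
  case True
  then have "{S. S \<subseteq> U \<and> T \<subseteq> S} = {U}" by auto
  then show ?thesis using True by simp
next
  case False
  then have "(\<Sum>S | S \<subseteq> U \<and> T \<subseteq> S. (- 1) ^ card S) = (0 :: 'b)"
    using card_subsupersets_even_odd[of U T] assms by (intro sum_alternating_cancels) auto
  then show ?thesis using False by simp
qed

context assoc_algebra
begin

text \<open>
  Substitute for \<open>x i\<close> the sum of the \<open>y j\<close> over those positions \<open>j \<in> S\<close> at which \<open>v0\<close> has the
  letter \<open>i\<close>. The alternating sum of the results over all \<open>S \<subseteq> {..<n}\<close> consists of the products that
  contain each of \<open>y 0, ..., y (n - 1)\<close>, and by the bound on the degree these are the products of
  \<open>y 0, ..., y (n - 1)\<close> in some order. The order \<open>0, ..., n - 1\<close> gets the coefficient of \<open>v0\<close>. No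
  splitting into homogeneous components is involved, so small fields cause no difficulty.
\<close>
lemma multilinear_identity:
  fixes f :: "'k ncpoly"
  assumes id: "satisfies_identity f" and const: "Poly_Mapping.lookup f [] = 0"
    and deg: "nc_degree f = n" and v0: "length v0 = n"
  shows "(\<Sum>js | length js = n \<and> set js = {..<n}.
           scale (Poly_Mapping.lookup f (map ((!) v0) js)) (list_prod (map y js))) = 0"
proof -
  define g where "g = (!) v0"
  define U where "U = {..<n}"
  define tm where "tm js = scale (Poly_Mapping.lookup f (map g js)) (list_prod (map y js))" for js
  define J where "J = (\<Union>v\<in>Poly_Mapping.keys f. choices U g v)"
  have "finite U" by (simp add: U_def)
  have "finite J" unfolding J_def using \<open>finite U\<close> finite_choices by auto
  have restricted: "(\<Sum>js | js \<in> J \<and> set js \<subseteq> S. tm js) = 0" if "S \<subseteq> U" for S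
  proof -
    have "finite S" using that \<open>finite U\<close> finite_subset by blast
    have "0 = nc_eval f (\<lambda>i. \<Sum>j | j \<in> S \<and> g j = i. y j)"
      using id by (simp add: satisfies_identity_def)
    also have "\<dots> = (\<Sum>v\<in>Poly_Mapping.keys f. \<Sum>js\<in>choices S g v. tm js)"
      unfolding nc_eval_def
    proof (rule sum.cong[OF refl])
      fix v assume "v \<in> Poly_Mapping.keys f"
      then have "v \<noteq> []" using const by (metis in_keys_iff)
      have "scale (Poly_Mapping.lookup f v) (list_prod (map (\<lambda>i. \<Sum>j | j \<in> S \<and> g j = i. y j) v))
          = (\<Sum>js\<in>choices S g v. scale (Poly_Mapping.lookup f v) (list_prod (map y js)))"
        by (simp only: list_prod_of_sums[OF \<open>v \<noteq> []\<close> \<open>finite S\<close>] scale_sum_right)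
      also have "\<dots> = (\<Sum>js\<in>choices S g v. tm js)"
        by (rule sum.cong) (auto simp: choices_def tm_def)
      finally show "scale (Poly_Mapping.lookup f v) (list_prod (map (\<lambda>i. \<Sum>j | j \<in> S \<and> g j = i. y j) v))
          = (\<Sum>js\<in>choices S g v. tm js)" .
    qed
    also have "\<dots> = (\<Sum>js\<in>(\<Union>v\<in>Poly_Mapping.keys f. choices S g v). tm js)"
      using \<open>finite S\<close> finite_choices by (intro sum.UNION_disjoint[symmetric]) (auto simp: choices_def)
    also have "(\<Union>v\<in>Poly_Mapping.keys f. choices S g v) = {js. js \<in> J \<and> set js \<subseteq> S}"
      using that by (auto simp: J_def choices_def)
    finally show ?thesis by simp
  qed
  have "0 = (\<Sum>S\<in>Pow U. scale ((- 1) ^ card S) (\<Sum>js | js \<in> J \<and> set js \<subseteq> S. tm js))"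
    using restricted by (simp add: Pow_iff)
  also have "\<dots> = (\<Sum>S\<in>Pow U. \<Sum>js | js \<in> J \<and> set js \<subseteq> S. scale ((- 1) ^ card S) (tm js))"
    by (simp add: scale_sum_right)
  also have "\<dots> = (\<Sum>js\<in>J. \<Sum>S | S \<in> Pow U \<and> set js \<subseteq> S. scale ((- 1) ^ card S) (tm js))"
    using \<open>finite J\<close> \<open>finite U\<close> by (intro sum.swap_restrict) auto
  also have "\<dots> = (\<Sum>js\<in>J. if set js = U then scale ((- 1) ^ card U) (tm js) else 0)"
  proof (rule sum.cong[OF refl])
    fix js assume "js \<in> J"
    then have "set js \<subseteq> U" by (auto simp: J_def choices_def)
    then show "(\<Sum>S | S \<in> Pow U \<and> set js \<subseteq> S. scale ((- 1) ^ card S) (tm js))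
        = (if set js = U then scale ((- 1) ^ card U) (tm js) else 0)"
      using alternating_sum_supersets[OF \<open>finite U\<close>, of "set js", where ?'b = 'k]
      by (simp flip: scale_sum_left)
  qed
  also have "\<dots> = (\<Sum>js | js \<in> J \<and> set js = U. scale ((- 1) ^ card U) (tm js))"
    using \<open>finite J\<close> by (simp add: sum.inter_filter)
  also have "\<dots> = scale ((- 1) ^ card U) (\<Sum>js | js \<in> J \<and> set js = U. tm js)"
    by (simp add: scale_sum_right)
  finally have "(\<Sum>js | js \<in> J \<and> set js = U. tm js) = 0"
    by simp
  moreover have "(\<Sum>js | js \<in> J \<and> set js = U. tm js) = (\<Sum>js | length js = n \<and> set js = U. tm js)"
  proof (rule sum.mono_neutral_left)
    show "finite {js. length js = n \<and> set js = U}"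
      by (rule finite_subset[OF _ finite_lists_length_eq[of U n]]) (use \<open>finite U\<close> in auto)
    show "{js. js \<in> J \<and> set js = U} \<subseteq> {js. length js = n \<and> set js = U}"
    proof
      fix js assume "js \<in> {js. js \<in> J \<and> set js = U}"
      then have js: "js \<in> J" "set js = U" by auto
      then have "map g js \<in> Poly_Mapping.keys f" by (auto simp: J_def choices_def)
      then have "length (map g js) \<le> n"
        unfolding deg[symmetric] nc_degree_def by (intro Max_ge finite_imageI imageI) simp_all
      moreover have "n \<le> length js" using card_length[of js] js(2) by (simp add: U_def)
      ultimately show "js \<in> {js. length js = n \<and> set js = U}" using js by simp
    qed
    show "\<forall>js\<in>{js. length js = n \<and> set js = U} - {js. js \<in> J \<and> set js = U}. tm js = 0"
      by (auto simp: J_def choices_def tm_def in_keys_iff)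
  qed
  ultimately show ?thesis by (simp add: tm_def g_def U_def)
qed

end

section \<open>Reduction to indivisible words\<close>

text \<open>
  At the first place where the permutation moves something, it puts a block that comes later in
  \<open>ws\<close>, and this block is dominated by the one that it replaces.
\<close>
lemma permuted_blocks_smaller:
  assumes dom: "sorted_wrt dominates ws" and len: "length ws = n"
    and js: "length js = n" "set js = {..<n}" "js \<noteq> [0..<n]"
  shows "(u @ concat (map ((!) ws) js), u @ concat ws) \<in> lex less_than"
proof -
  have "distinct js" using js(1,2) by (simp add: card_distinct)
  have "\<exists>i<n. js ! i \<noteq> i"
  proof (rule ccontr)
    assume "\<not> ?thesis"
    then have "js = [0..<n]" using js(1) by (intro nth_equalityI) auto
    then show False using js(3) by simp
  qed
  define i where "i = (LEAST i. i < n \<and> js ! i \<noteq> i)"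
  have i: "i < n" "js ! i \<noteq> i" unfolding i_def using LeastI_ex[OF \<open>\<exists>i<n. js ! i \<noteq> i\<close>] by simp_all
  have before: "js ! k = k" if "k < i" for k
    using not_less_Least[of k "\<lambda>i. i < n \<and> js ! i \<noteq> i"] that i by (auto simp: i_def[symmetric])
  have "js ! i < n" using js(1,2) i(1) nth_mem[of i js] by auto
  moreover have "i < js ! i"
  proof (rule ccontr)
    assume "\<not> ?thesis"
    then have "js ! (js ! i) = js ! i" using before[of "js ! i"] i(2) by simp
    then show False using nth_eq_iff_index_eq[OF \<open>distinct js\<close>, of "js ! i" i] i js(1) \<open>js ! i < n\<close> by simp
  qed
  ultimately have "dominates (ws ! i) (ws ! (js ! i))"
    using sorted_wrt_nth_less[OF dom] len by simp
  then obtain p x y a b where ab: "ws ! i = p @ x # a" "ws ! (js ! i) = p @ y # b" "y < x"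
    unfolding dominates_def by blast
  have ws: "ws = take i ws @ ws ! i # drop (Suc i) ws"
    using i(1) len by (simp add: id_take_nth_drop)
  have "js = take i js @ js ! i # drop (Suc i) js"
    using i(1) js(1) by (simp add: id_take_nth_drop)
  moreover have "map ((!) ws) (take i js) = take i ws"
    using before i(1) js(1) len by (intro nth_equalityI) auto
  ultimately have map_js: "map ((!) ws) js = take i ws @ ws ! (js ! i) # map ((!) ws) (drop (Suc i) js)"
    by (metis list.simps(9) map_append)
  have "mset js = mset [0..<n]"
    using set_eq_iff_mset_eq_distinct[OF \<open>distinct js\<close>, of "[0..<n]"] js(2) by (simp add: lessThan_atLeast0)
  then have "mset (map ((!) ws) js) = mset (map ((!) ws) [0..<n])" by (simp only: mset_map)
  then have "mset (map ((!) ws) js) = mset ws" by (simp only: len[symmetric] map_nth)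
  then have "sum_mset (image_mset length (mset (map ((!) ws) js))) = sum_mset (image_mset length (mset ws))"
    by (simp only:)
  then have "sum_list (map length (map ((!) ws) js)) = sum_list (map length ws)"
    by (simp only: mset_map[symmetric] sum_mset_sum_list)
  then have "length (concat (map ((!) ws) js)) = length (concat ws)"
    by (simp only: length_concat)
  moreover have "concat ws = concat (take i ws) @ p @ x # (a @ concat (drop (Suc i) ws))"
    by (subst ws) (simp add: ab)
  moreover have "concat (map ((!) ws) js)
      = concat (take i ws) @ p @ y # (b @ concat (map ((!) ws) (drop (Suc i) js)))"
    unfolding map_js by (simp add: ab)
  ultimately show ?thesis using ab(3) unfolding lex_conv
    by (intro CollectI case_prodI conjI exI[of _ "u @ concat (take i ws) @ p"]) auto
qed

context assoc_algebra
begin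

lemma divisible_word_reduces:
  fixes f :: "'k ncpoly"
  assumes id: "satisfies_identity f" and adm: "admissible f" and deg: "nc_degree f = n" and "2 \<le> n"
    and div: "n_divisible n w"
  shows "list_prod (map a w) \<in> span {list_prod (map a w') | w'. w' \<noteq> [] \<and> set w' \<subseteq> set w \<and> (w', w) \<in> lex less_than}"
    (is "_ \<in> span ?A")
proof -
  obtain u ws where w: "w = u @ concat ws" "length ws = n" "sorted_wrt dominates ws"
    using div unfolding n_divisible_def by blast
  have block: "ws ! j \<noteq> []" if "j < n" for j
  proof -
    obtain j' where "j' < n" "j' \<noteq> j" using \<open>2 \<le> n\<close> by (metis One_nat_def less_2_cases_iff less_le_trans zero_neq_one)
    then have "dominates (ws ! j) (ws ! j') \<or> dominates (ws ! j') (ws ! j)"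
      using sorted_wrt_nth_less[OF w(3)] w(2) that by (metis linorder_neqE_nat)
    then show ?thesis by (auto simp: dominates_def)
  qed
  obtain v0 where v0: "length v0 = n" "Poly_Mapping.lookup f v0 = 1"
    using adm deg unfolding admissible_def by blast
  define P where "P = {js. length js = n \<and> set js = {..<n}}"
  define c where "c js = Poly_Mapping.lookup f (map ((!) v0) js)" for js
  define y where "y j = list_prod (map a (ws ! j))" for j
  define pre where "pre x = (if u = [] then x else list_prod (map a u) * x)" for x
  define perm where "perm js = u @ concat (map ((!) ws) js)" for js
  have "finite P" unfolding P_def
    by (rule finite_subset[OF _ finite_lists_length_eq[of "{..<n}" n]]) auto
  have pre_sum: "pre (\<Sum>js\<in>P. scale (c js) (z js)) = (\<Sum>js\<in>P. scale (c js) (pre (z js)))" for z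
    by (simp add: pre_def sum_distrib_left scale_mult_right)
  have pre_word: "pre (list_prod (map y js)) = list_prod (map a (perm js))" if "js \<in> P" for js
  proof -
    have "length js = n" "set js = {..<n}" using that by (simp_all add: P_def)
    then have js: "js \<noteq> []" "\<And>j. j \<in> set js \<Longrightarrow> ws ! j \<noteq> []" using \<open>2 \<le> n\<close> block by auto
    then have ne: "[] \<notin> set (map (\<lambda>j. map a (ws ! j)) js)" by auto
    have y: "list_prod (map y js) = list_prod (concat (map (\<lambda>j. map a (ws ! j)) js))"
      using list_prod_concat[OF _ ne] js(1) by (simp add: y_def[abs_def] comp_def)
    have "concat (map (\<lambda>j. map a (ws ! j)) js) \<noteq> []" using ne js(1) by (cases js) auto
    then show ?thesis
      unfolding pre_def y perm_def by (auto simp: list_prod_append map_concat comp_def)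
  qed
  have "0 = pre (\<Sum>js\<in>P. scale (c js) (list_prod (map y js)))"
    using multilinear_identity[OF id _ deg v0(1), of y] adm by (simp add: P_def c_def admissible_def pre_def)
  also have "\<dots> = (\<Sum>js\<in>P. scale (c js) (list_prod (map a (perm js))))"
    unfolding pre_sum using pre_word by (intro sum.cong) auto
  also have "\<dots> = scale (c [0..<n]) (list_prod (map a (perm [0..<n])))
      + (\<Sum>js\<in>P - {[0..<n]}. scale (c js) (list_prod (map a (perm js))))"
    using \<open>finite P\<close> by (intro sum.remove) (auto simp: P_def)
  also have "scale (c [0..<n]) (list_prod (map a (perm [0..<n]))) = list_prod (map a w)"
    using map_nth[of v0, unfolded v0(1)] map_nth[of ws, unfolded w(2)] v0(2) w(1)
    by (simp only: c_def perm_def scale_one)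
  finally have "list_prod (map a w) = - (\<Sum>js\<in>P - {[0..<n]}. scale (c js) (list_prod (map a (perm js))))"
    by (simp add: eq_neg_iff_add_eq_0)
  also have "\<dots> \<in> span ?A"
  proof (intro span_neg span_sum span_scale span_base)
    fix js assume js: "js \<in> P - {[0..<n]}"
    have "(perm js, w) \<in> lex less_than"
      unfolding perm_def w(1) using js by (intro permuted_blocks_smaller[OF w(3,2)]) (auto simp: P_def)
    moreover have "set (perm js) \<subseteq> set w" using js w(2) by (auto simp: perm_def w(1) P_def)
    moreover have "perm js \<noteq> []"
      using calculation(1) by (auto simp: lex_conv)
    ultimately show "list_prod (map a (perm js)) \<in> ?A" by blast
  qed
  finally show ?thesis .
qed

lemma word_in_span_of_indivisible:
  fixes f :: "'k ncpoly"
  assumes "satisfies_identity f" "admissible f" "nc_degree f = n" "2 \<le> n" "w \<noteq> []"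
  shows "list_prod (map a w) \<in> span {list_prod (map a w') | w'. w' \<noteq> [] \<and> set w' \<subseteq> set w \<and> \<not> n_divisible n w'}"
  using assms(5)
proof (induction w rule: wf_induct[OF wf_lex[OF wf_less_than]])
  case (1 w)
  show ?case
  proof (cases "n_divisible n w")
    case True
    have "{list_prod (map a w') | w'. w' \<noteq> [] \<and> set w' \<subseteq> set w \<and> (w', w) \<in> lex less_than}
        \<subseteq> span {list_prod (map a w') | w'. w' \<noteq> [] \<and> set w' \<subseteq> set w \<and> \<not> n_divisible n w'}"
    proof clarify
      fix w' assume w': "w' \<noteq> []" "set w' \<subseteq> set w" "(w', w) \<in> lex less_than"
      then have "list_prod (map a w') \<in> span {list_prod (map a w'') | w''. w'' \<noteq> [] \<and> set w'' \<subseteq> set w' \<and> \<not> n_divisible n w''}"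
        using 1 by blast
      then show "list_prod (map a w') \<in> span {list_prod (map a w') | w'. w' \<noteq> [] \<and> set w' \<subseteq> set w \<and> \<not> n_divisible n w'}"
        by (rule set_rev_mp) (intro span_mono, use w'(2) in blast)
    qed
    then show ?thesis
      using divisible_word_reduces[OF assms(1-4) True, of a] span_minimal[OF _ subspace_span] by blast
  next
    case False
    then show ?thesis using 1 by (intro span_base) blast
  qed
qed

text \<open>
  An identity element is adjoined separately, since it is not a product of generators in general.
\<close>
lemma span_of_words:
  assumes "generates X"
  shows "span ({list_prod w | w. w \<noteq> [] \<and> set w \<subseteq> X} \<union> {e. \<forall>x. e * x = x \<and> x * e = x}) = UNIV"
    (is "span (?W \<union> ?E) = _")
proof -
  have base: "x * y \<in> span (?W \<union> ?E)" if "x \<in> ?W \<union> ?E" "y \<in> ?W \<union> ?E" for x y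
  proof -
    from that consider "x \<in> ?E" | "y \<in> ?E" | "x \<in> ?W" "y \<in> ?W" by (elim UnE)
    then have "x * y \<in> ?W \<union> ?E"
    proof cases
      case 3
      then obtain w w' where w: "x = list_prod w" "w \<noteq> []" "set w \<subseteq> X"
        "y = list_prod w'" "w' \<noteq> []" "set w' \<subseteq> X" by blast
      then have "x * y = list_prod (w @ w')" by (simp add: list_prod_append)
      moreover have "w @ w' \<noteq> []" "set (w @ w') \<subseteq> X" using w by auto
      ultimately show ?thesis by blast
    qed (use that in auto)
    then show ?thesis by (rule span_base)
  qed
  have left: "x * y \<in> span (?W \<union> ?E)" if "x \<in> span (?W \<union> ?E)" "y \<in> ?W \<union> ?E" for x y
    using that(1)
  proof (induction rule: span_induct_alt)
    case (step c b z)
    then show ?case using base that(2) by (simp add: distrib_right scale_mult_left span_add span_scale)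
  qed (simp add: span_zero)
  have "x * y \<in> span (?W \<union> ?E)" if "x \<in> span (?W \<union> ?E)" "y \<in> span (?W \<union> ?E)" for x y
    using that(2)
  proof (induction rule: span_induct_alt)
    case (step c b z)
    then show ?case using left that(1) by (simp add: distrib_left scale_mult_right span_add span_scale)
  qed (simp add: span_zero)
  then have "subalgebra (span (?W \<union> ?E))" by (simp add: subalgebra_def)
  moreover have "X \<union> ?E \<subseteq> span (?W \<union> ?E)"
  proof -
    have "x \<in> ?W" if "x \<in> X" for x using that by (intro CollectI exI[of _ "[x]"]) simp
    then show ?thesis using span_superset[of "?W \<union> ?E"] by blast
  qed
  ultimately have "subalgebra hull (X \<union> ?E) \<subseteq> span (?W \<union> ?E)" by (intro hull_minimal)
  then show ?thesis using assms unfolding generates_def by blast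
qed

end

section \<open>Essential height\<close>

text \<open>Empty gaps are omitted, as an algebra without unit has no product of the empty word.\<close>
fun factor_words :: "('a list \<times> 'a list \<times> nat) list \<Rightarrow> 'a list \<Rightarrow> 'a list list" where
  "factor_words [] e = (if e = [] then [] else [e])"
| "factor_words ((d, u, k) # fs) e =
    (if d = [] then [] else [d]) @ concat (replicate k u) # factor_words fs e"

lemma concat_factor_words: "concat (factor_words fs e) = assemble fs e"
  by (induction fs e rule: factor_words.induct) auto

lemma length_factor_words: "length (factor_words fs e) \<le> 2 * length fs + 1"
  by (induction fs e rule: factor_words.induct) auto

lemma factor_words_greedy:
  assumes "greedy N n 1 fs e" "v \<in> set (factor_words fs e)"
  shows "v \<noteq> [] \<and> (length v \<le> N \<or> (\<exists>u k. v = concat (replicate k u) \<and> u \<noteq> [] \<and> length u < n \<and> k > 0))"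
  using assms
proof (induction fs e rule: factor_words.induct)
  case (2 d u k fs e)
  then consider "v = d" "d \<noteq> []" | "v = concat (replicate k u)" | "v \<in> set (factor_words fs e)"
    by (auto split: if_splits)
  then show ?case
  proof cases
    case 2
    moreover have "u \<noteq> []" "length u < n" "k > 0" using "2.prems"(1) by auto
    ultimately show ?thesis by auto
  qed (use 2 in auto)
qed (auto split: if_splits)

lemma long_factor_words:
  assumes "greedy N n 1 fs e"
  shows "length (filter (\<lambda>v. N < length v) (factor_words fs e)) \<le> length fs"
  using assms by (induction fs e rule: factor_words.induct) auto

context assoc_algebra
begin

lemma indivisible_word_essential:
  assumes D: "\<And>v. v \<noteq> [] \<Longrightarrow> set v \<subseteq> {..<l} \<Longrightarrow> length v \<le> N \<Longrightarrow> list_prod (map a v) \<in> D"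
    and a: "\<And>i. i < l \<Longrightarrow> a i \<in> X"
    and w: "set w \<subseteq> {..<l}" "w \<noteq> []" and fs: "w = assemble fs e" "greedy N n 1 fs e" "length fs \<le> h"
  shows "list_prod (map a w) \<in> essential_products (words_below X n) D h"
proof -
  define vs where "vs = factor_words fs e"
  define ts where "ts = map (\<lambda>v. list_prod (map a v)) vs"
  have concat_vs: "concat vs = w" by (simp add: vs_def concat_factor_words fs(1))
  have "vs \<noteq> []" using concat_vs w(2) by auto
  have vs: "v \<noteq> []" "set v \<subseteq> {..<l}"
    "length v \<le> N \<or> (\<exists>u k. v = concat (replicate k u) \<and> u \<noteq> [] \<and> length u < n \<and> k > 0)"
    if "v \<in> set vs" for v
  proof -
    show "v \<noteq> []" "length v \<le> N \<or> (\<exists>u k. v = concat (replicate k u) \<and> u \<noteq> [] \<and> length u < n \<and> k > 0)"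
      using factor_words_greedy[OF fs(2)] that by (auto simp: vs_def)
    have "set v \<subseteq> set (concat vs)" using that by auto
    then show "set v \<subseteq> {..<l}" using w(1) concat_vs by blast
  qed
  have "list_prod (map a w) = list_prod ts"
  proof -
    have "map a w = concat (map (map a) vs)" by (simp add: concat_vs[symmetric] map_concat)
    then show ?thesis using list_prod_concat[of "map (map a) vs"] vs(1) \<open>vs \<noteq> []\<close>
      by (auto simp: ts_def comp_def)
  qed
  moreover have "ts \<noteq> []" using \<open>vs \<noteq> []\<close> by (simp add: ts_def)
  moreover have "length ts \<le> 2 * h + 1"
    using length_factor_words[of fs e] fs(3) by (simp add: ts_def vs_def)
  moreover have "t \<in> D \<or> (\<exists>y\<in>words_below X n. \<exists>k>0. t = list_prod (replicate k y))" if t: "t \<in> set ts" for t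
  proof -
    obtain v where v: "v \<in> set vs" "t = list_prod (map a v)" using t by (auto simp: ts_def)
    show ?thesis
    proof (cases "length v \<le> N")
      case True
      then show ?thesis using D vs v by blast
    next
      case False
      then obtain u k where u: "v = concat (replicate k u)" "u \<noteq> []" "length u < n" "k > 0"
        using vs(3)[OF v(1)] by blast
      then have "set u \<subseteq> {..<l}" using vs(2)[OF v(1)] by auto
      then have "list_prod (map a u) \<in> words_below X n"
        unfolding words_below_def using u a by (intro CollectI exI[of _ "map a u"]) auto
      moreover have "t = list_prod (replicate k (list_prod (map a u)))"
        using list_prod_concat[of "replicate k (map a u)"] u v(2) by (simp add: map_concat)
      ultimately show ?thesis using u(4) by blast
    qed
  qed
  moreover have "card {i. i < length ts \<and> ts ! i \<notin> D} \<le> h"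
  proof -
    have "card {i. i < length ts \<and> ts ! i \<notin> D} = card {i. i < length vs \<and> list_prod (map a (vs ! i)) \<notin> D}"
      by (intro arg_cong[of _ _ card]) (auto simp: ts_def)
    also have "\<dots> \<le> card {i. i < length vs \<and> N < length (vs ! i)}"
    proof (intro card_mono)
      show "{i. i < length vs \<and> list_prod (map a (vs ! i)) \<notin> D} \<subseteq> {i. i < length vs \<and> N < length (vs ! i)}"
      proof clarify
        fix i assume i: "i < length vs" "list_prod (map a (vs ! i)) \<notin> D"
        then have "vs ! i \<in> set vs" by simp
        then show "N < length (vs ! i)" using D[OF vs(1,2)] i by fastforce
      qed
    qed simp
    also have "\<dots> \<le> length fs"
      using long_factor_words[OF fs(2)] by (simp add: vs_def length_filter_conv_card)
    finally show ?thesis using fs(3) by simp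
  qed
  ultimately show ?thesis unfolding essential_products_def
    by (intro CollectI exI[of _ ts]) (auto simp: in_set_conv_nth)
qed

lemma essentially_spanned_of_degree:
  fixes f :: "'k ncpoly"
  assumes "satisfies_identity f" "admissible f" "nc_degree f = n" "2 \<le> n"
    and gen: "generates (set xs)" and "xs \<noteq> []" and t: "n \<le> 3 ^ t"
  shows "essentially_spanned (words_below (set xs) n) (2 * n ^ (3 * t + 4) * length xs - 1)"
    (is "essentially_spanned ?Y ?h")
proof -
  define l where "l = length xs"
  define E where "E = {e :: 'a. \<forall>x. e * x = x \<and> x * e = x}"
  have "n > 0" "l > 0" using \<open>2 \<le> n\<close> \<open>xs \<noteq> []\<close> by (auto simp: l_def)
  obtain N where N: "\<forall>w. set w \<subseteq> {..<l} \<longrightarrow> \<not> n_divisible n w \<longrightarrow>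
    (\<exists>fs e. w = assemble fs e \<and> greedy N n 1 fs e \<and> length fs < 2 * n ^ (3 * t + 4) * l)"
    using sparse_decomposition[OF \<open>n > 0\<close> \<open>l > 0\<close> t] by blast
  \<comment> \<open>The short gaps of all decompositions, and the identity element if there is one.\<close>
  define D where "D = (\<lambda>v. list_prod (map ((!) xs) v)) ` {v. set v \<subseteq> {..<l} \<and> length v \<le> N} \<union> E"
  have "finite D"
  proof -
    have "e = e'" if "e \<in> E" "e' \<in> E" for e e'
    proof -
      have "e * e' = e'" "e * e' = e" using that unfolding E_def by blast+
      then show ?thesis by simp
    qed
    then have "\<exists>e. E \<subseteq> {e}" by blast
    then have "finite E" using finite_subset by blast
    then show ?thesis by (simp add: D_def finite_lists_length_le)
  qed
  have essential: "list_prod (map ((!) xs) w) \<in> essential_products ?Y D ?h"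
    if w: "w \<noteq> []" "set w \<subseteq> {..<l}" "\<not> n_divisible n w" for w
  proof -
    obtain fs e where fs: "w = assemble fs e" "greedy N n 1 fs e" "length fs < 2 * n ^ (3 * t + 4) * l"
      using N w by blast
    show ?thesis
      by (rule indivisible_word_essential[of l N _ D]) (use w fs in \<open>auto simp: D_def l_def\<close>)
  qed
  have "list_prod v \<in> span (essential_products ?Y D ?h)" if "v \<noteq> []" "set v \<subseteq> set xs" for v
  proof -
    have "\<exists>i<l. xs ! i = x" if "x \<in> set v" for x
      using that \<open>set v \<subseteq> set xs\<close> by (metis in_set_conv_nth l_def subsetD)
    then obtain g where g: "\<And>x. x \<in> set v \<Longrightarrow> g x < l \<and> xs ! g x = x" by metis
    define w where "w = map g v"
    have w: "w \<noteq> []" "set w \<subseteq> {..<l}" "map ((!) xs) w = v"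
      using g that(1) by (auto simp: w_def map_idI)
    have "{list_prod (map ((!) xs) w') | w'. w' \<noteq> [] \<and> set w' \<subseteq> set w \<and> \<not> n_divisible n w'}
        \<subseteq> essential_products ?Y D ?h"
      using essential w(2) by blast
    then show ?thesis
      using word_in_span_of_indivisible[OF assms(1-4) w(1), of "(!) xs"] span_mono w(3) by blast
  qed
  moreover have "e \<in> span (essential_products ?Y D ?h)" if "e \<in> E" for e
  proof (intro span_base)
    have "e \<in> D" using that by (simp add: D_def)
    then have in_D: "[e] ! i \<in> D" if "i < length [e]" for i
      using that by simp
    then have "{i. i < length [e] \<and> [e] ! i \<notin> D} = {}" by blast
    then show "e \<in> essential_products ?Y D ?h"
      unfolding essential_products_def using in_D
      by (intro CollectI exI[of _ "[e]"] conjI) (simp_all only:, simp_all)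
  qed
  ultimately have "{list_prod w | w. w \<noteq> [] \<and> set w \<subseteq> set xs} \<union> E \<subseteq> span (essential_products ?Y D ?h)"
    by blast
  then have "span ({list_prod w | w. w \<noteq> [] \<and> set w \<subseteq> set xs} \<union> E) \<subseteq> span (essential_products ?Y D ?h)"
    by (rule span_minimal[OF _ subspace_span])
  then have "span (essential_products ?Y D ?h) = UNIV"
    unfolding E_def span_of_words[OF gen] by (simp add: top.extremum_unique)
  then show ?thesis unfolding essentially_spanned_def using \<open>finite D\<close> by blast
qed

text \<open>
  In degree one there is only one permutation and the multilinear identity reads \<open>y 0 = 0\<close>.
  This case is separate because a single block of a divisible word may be empty.
\<close>
lemma trivial_of_degree_one:
  fixes f :: "'k ncpoly"
  assumes "satisfies_identity f" "admissible f" "nc_degree f = 1"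
  shows "(x :: 'a) = 0"
proof -
  obtain v0 where v0: "length v0 = 1" "Poly_Mapping.lookup f v0 = 1" "Poly_Mapping.lookup f [] = 0"
    using assms(2,3) unfolding admissible_def by metis
  have zero: "{..<1} = {0 :: nat}" by auto
  have "js = [0]" if "length js = 1" "set js = {..<1}" for js :: "nat list"
    using that unfolding zero by (cases js) auto
  then have "{js :: nat list. length js = 1 \<and> set js = {..<1}} = {[0]}"
    using zero by auto
  moreover have "map ((!) v0) [0] = v0" using v0(1) by (cases v0) auto
  ultimately show ?thesis
    using multilinear_identity[OF assms(1) v0(3) assms(3) v0(1), of "\<lambda>_. x"] v0(2) by simp
qed

lemma essential_height_exists:
  assumes "finite Y" "essentially_spanned Y h0"
  shows "\<exists>h\<le>h0. has_essential_height Y h"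
proof -
  define h where "h = (LEAST h. essentially_spanned Y h)"
  have "essentially_spanned Y h" unfolding h_def using assms(2) by (rule LeastI)
  moreover have "\<not> essentially_spanned Y h'" if "h' < h" for h'
    using not_less_Least that unfolding h_def by blast
  moreover have "h \<le> h0" unfolding h_def using assms(2) by (rule Least_le)
  ultimately show ?thesis using assms(1) unfolding has_essential_height_def by blast
qed

lemma essential_height_less_Upsilon:
  fixes f :: "'k ncpoly"
  assumes "n > 0" "l > 0" "length xs = l" "generates (set xs)"
    and "admissible f" "nc_degree f = n" "satisfies_identity f"
  shows "\<exists>h. has_essential_height (words_below (set xs) n) h \<and> h < Upsilon n l"
proof -
  have "finite (words_below (set xs) n)"
  proof -
    have "words_below (set xs) n \<subseteq> list_prod ` {w. set w \<subseteq> set xs \<and> length w \<le> n}"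
      by (auto simp: words_below_def)
    then show ?thesis by (rule finite_subset) (simp add: finite_lists_length_le)
  qed
  moreover have "Upsilon n l > 0" using assms(1,2) by (simp add: Upsilon_def)
  moreover have "essentially_spanned (words_below (set xs) n) (Upsilon n l - 1)"
  proof (cases "n = 1")
    case True
    then have "x = 0" for x :: 'a using trivial_of_degree_one assms(5-7) by blast
    then have "span (essential_products (words_below (set xs) n) {} (Upsilon n l - 1)) = UNIV"
      using span_zero by (metis UNIV_eq_I)
    then show ?thesis unfolding essentially_spanned_def by blast
  next
    case False
    define t where "t = nat \<lceil>log 3 (real n)\<rceil>"
    have "real n = 3 powr log 3 (real n)" using \<open>n > 0\<close> by simp
    also have "\<dots> \<le> 3 powr real t" unfolding t_def by (intro powr_mono real_nat_ceiling_ge) simp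
    also have "\<dots> = 3 ^ t" by (simp add: powr_realpow)
    finally have "n \<le> 3 ^ t" by (metis of_nat_le_iff of_nat_numeral of_nat_power)
    then show ?thesis
      using essentially_spanned_of_degree[OF assms(7,5,6) _ assms(4), of t] False assms(1-3)
      by (auto simp: Upsilon_def t_def)
  qed
  ultimately show ?thesis using essential_height_exists by (metis Suc_pred' less_Suc_eq_le)
qed

end

theorem theorem12:
  fixes scale :: "'k::field \<Rightarrow> 'a::ring \<Rightarrow> 'a"
    and xs :: "'a list" and f :: "'k ncpoly" and n l :: nat
  assumes "assoc_algebra scale"
    and "n > 0" and "l > 0"
    and "length xs = l" and "assoc_algebra.generates scale (set xs)"
    and "admissible f" and "nc_degree f = n" and "assoc_algebra.satisfies_identity scale f"
  shows "\<exists>h. assoc_algebra.has_essential_height scale (words_below (set xs) n) h \<and> h < Upsilon n l"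
  by (rule assoc_algebra.essential_height_less_Upsilon[OF assms])

end
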